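(* Let $\kappa$ be an uncountable cardinal. If $\mathbb{Q}^1_\kappa = ([\kappa]^\kappa,\supseteq)$ collapses $2^\kappa$ to $\aleph_0$, $\mathrm{cf}(\kappa) > \aleph_0$, and $2^{2^{<\kappa}} = 2^\kappa$, then $\mathbb{Q}^2_\kappa$ adds a $\kappa$-Cohen real.
   Context: Conventions: in a forcing order $(\mathbb{P},\leq_{\mathbb{P}})$, $p \leq_{\mathbb{P}} q$ means that $q$ is stronger than $p$. "$\mathbb{P}$ collapses $\lambda$ to $\theta$" means that the weakest condition of $\mathbb{P}$ forces $|\check\lambda| = \theta$; $2^\kappa$ is computed in the ground model. ${}^{\kappa>}\kappa$ is the set of functions $f\colon\alpha\to\kappa$ with $\alpha<\kappa$ (for such $f$, $\alpha$ is the length of $f$), $\trianglelefteq$ is end extension of such functions, and $t^\frown\langle i\rangle = t\cup\{(\mathrm{dom}(t),i)\}$. $\mathbb{Q}^1_\kappa$ is the forcing $([\kappa]^\kappa,\supseteq)$: conditions are the subsets of $\kappa$ of size $\kappa$, and $a\leq b$ iff $b\subseteq a$ (subsets are stronger; the weakest condition is $\kappa$). $\mathbb{Q}^2_\kappa$ (a version of $\kappa$-Miller forcing): conditions are (nonempty, closed under initial segments) trees $T\subseteq {}^{\kappa>}\kappa$ such that (i) for each $s\in T$ there is $t\in T$ with $s\trianglelefteq t$ that is a $\kappa$-splitting node of $T$, i.e., $\{i<\kappa : t^\frown\langle i\rangle\in T\}$ has size $\kappa$; (ii) the limit (union) of any sequence of length less than $\kappa$ of $\kappa$-splitting nodes of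 $T$ that is increasing in the tree order is a $\kappa$-splitting node of $T$, provided this limit has length less than $\kappa$. The order is $p\leq q$ iff $q\subseteq p$ (subtrees are stronger; the weakest condition is ${}^{\kappa>}\kappa$). $\kappa$-Cohen forcing $\mathbb{C}(\kappa)$ is the set ${}^{\kappa>}2$ of functions from ordinals $<\kappa$ to $2$, ordered by end extension (longer functions are stronger). A forcing adds a $\kappa$-Cohen real if every generic extension $\mathbf{V}[G]$ by it contains a filter on $\mathbb{C}(\kappa)^{\mathbf{V}}$ that is $\mathbb{C}(\kappa)^{\mathbf{V}}$-generic over $\mathbf{V}$. *)

theory Defs
  imports Main
begin

unbundle cardinal_syntax

section \<open>Cardinals and sequences\<close>

text \<open>A cardinal \<open>\<kappa>\<close> is a relation satisfying \<open>Card_order \<kappa>\<close>.  The ordinals below \<open>\<kappa>\<close> are the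
  elements of \<open>Field \<kappa>\<close>; such an ordinal \<open>\<alpha>\<close>, as a set of ordinals, is \<open>underS \<kappa> \<alpha>\<close>.\<close>

definition cofinality :: "'k rel \<Rightarrow> 'k rel" where
  "cofinality \<kappa> =
     |SOME A. A \<subseteq> Field \<kappa> \<and> cofinal A \<kappa> \<and> (\<forall>B. B \<subseteq> Field \<kappa> \<and> cofinal B \<kappa> \<longrightarrow> |A| \<le>o |B| )|"

text \<open>The set of functions from ordinals below \<open>\<kappa>\<close> to \<open>B\<close>.  On such functions end extension is
  \<open>\<subseteq>\<^sub>m\<close>, because their domains are initial segments of \<open>\<kappa>\<close>.\<close>

definition seqs :: "'k rel \<Rightarrow> 'b set \<Rightarrow> ('k \<rightharpoonup> 'b) set" where
  "seqs \<kappa> B = {f. (\<exists>\<alpha>\<in>Field \<kappa>. dom f = underS \<kappa> \<alpha>) \<and> ran f \<subseteq> B}"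

definition len :: "'k rel \<Rightarrow> ('k \<rightharpoonup> 'b) \<Rightarrow> 'k" where
  "len \<kappa> f = (THE \<alpha>. \<alpha> \<in> Field \<kappa> \<and> dom f = underS \<kappa> \<alpha>)"

definition snoc :: "'k rel \<Rightarrow> ('k \<rightharpoonup> 'b) \<Rightarrow> 'b \<Rightarrow> ('k \<rightharpoonup> 'b)" where
  "snoc \<kappa> t i = t(len \<kappa> t \<mapsto> i)"

text \<open>The cardinal \<open>2\<^bsup><\<kappa>\<^esup>\<close>, as the number of functions from ordinals below \<open>\<kappa>\<close> to \<open>2\<close>.\<close>

definition two_less :: "'k rel \<Rightarrow> ('k \<rightharpoonup> bool) rel" where
  "two_less \<kappa> = |seqs \<kappa> (UNIV :: bool set)|"


section \<open>Forcing\<close>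

text \<open>\<open>le \<P> p q\<close> means that \<open>q\<close> is stronger than \<open>p\<close>.\<close>

record 'p forcing =
  conds :: "'p set"
  le :: "'p \<Rightarrow> 'p \<Rightarrow> bool"
  weakest :: 'p

text \<open>The ground model is the surrounding logic.  A sentence of the forcing language is represented by
  the predicate ``\<open>p\<close> forces the sentence'' on conditions \<open>p\<close>, and the clauses of the usual
  definition of the forcing relation become operations on such predicates.

  Quantifiers over elements of the extension are needed only in two forms.  Elements of a
  ground-model set \<open>A\<close> are named by their check names, i.e. by the elements of \<open>A\<close>.  Subsets of \<open>A\<close>
  that lie in the extension are named by the sets of pairs \<open>(x, p)\<close> with \<open>x \<in> A\<close> and \<open>p\<close> a
  condition: the value of the name \<open>\<tau>\<close> in \<open>V[G]\<close> is \<open>{x. \<exists>p\<in>G. (x, p) \<in> \<tau>}\<close>, and every subset of \<open>A\<close>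
  in \<open>V[G]\<close> is the value of such a name.\<close>

type_synonym 'p sentence = "'p \<Rightarrow> bool"

definition names :: "'p forcing \<Rightarrow> 'a set \<Rightarrow> ('a \<times> 'p) set set" where
  "names \<P> A = Pow (A \<times> conds \<P>)"

definition dense_above :: "'p forcing \<Rightarrow> 'p \<Rightarrow> ('p \<Rightarrow> bool) \<Rightarrow> bool" where
  "dense_above \<P> p X \<longleftrightarrow>
     (\<forall>q\<in>conds \<P>. le \<P> p q \<longrightarrow> (\<exists>r\<in>conds \<P>. le \<P> q r \<and> X r))"

definition f_mem :: "'p forcing \<Rightarrow> 'a \<Rightarrow> ('a \<times> 'p) set \<Rightarrow> 'p sentence" where
  "f_mem \<P> x \<tau> = (\<lambda>p. dense_above \<P> p (\<lambda>r. \<exists>s. (x, s) \<in> \<tau> \<and> le \<P> s r))"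

definition f_eq :: "'a \<Rightarrow> 'a \<Rightarrow> 'p sentence" where
  "f_eq x y = (\<lambda>p. x = y)"

definition f_and :: "'p sentence \<Rightarrow> 'p sentence \<Rightarrow> 'p sentence" where
  "f_and \<phi> \<psi> = (\<lambda>p. \<phi> p \<and> \<psi> p)"

definition f_not :: "'p forcing \<Rightarrow> 'p sentence \<Rightarrow> 'p sentence" where
  "f_not \<P> \<phi> = (\<lambda>p. \<forall>q\<in>conds \<P>. le \<P> p q \<longrightarrow> \<not> \<phi> q)"

definition f_imp :: "'p forcing \<Rightarrow> 'p sentence \<Rightarrow> 'p sentence \<Rightarrow> 'p sentence" where
  "f_imp \<P> \<phi> \<psi> = f_not \<P> (f_and \<phi> (f_not \<P> \<psi>))"

definition f_all :: "'n set \<Rightarrow> ('n \<Rightarrow> 'p sentence) \<Rightarrow> 'p sentence" where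
  "f_all N \<phi> = (\<lambda>p. \<forall>\<tau>\<in>N. \<phi> \<tau> p)"

definition f_ex :: "'p forcing \<Rightarrow> 'n set \<Rightarrow> ('n \<Rightarrow> 'p sentence) \<Rightarrow> 'p sentence" where
  "f_ex \<P> N \<phi> = (\<lambda>p. dense_above \<P> p (\<lambda>r. \<exists>\<tau>\<in>N. \<phi> \<tau> r))"


subsection \<open>Collapsing a cardinal\<close>

definition f_bij :: "'p forcing \<Rightarrow> (('a \<times> 'b) \<times> 'p) set \<Rightarrow> 'a set \<Rightarrow> 'b set \<Rightarrow> 'p sentence" where
  "f_bij \<P> F A B =
     f_and (f_all A (\<lambda>x. f_ex \<P> B (\<lambda>y. f_mem \<P> (x, y) F)))
    (f_and (f_all B (\<lambda>y. f_ex \<P> A (\<lambda>x. f_mem \<P> (x, y) F)))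
    (f_and (f_all A (\<lambda>x. f_all B (\<lambda>y. f_all B (\<lambda>y'.
              f_imp \<P> (f_and (f_mem \<P> (x, y) F) (f_mem \<P> (x, y') F)) (f_eq y y')))))
           (f_all A (\<lambda>x. f_all A (\<lambda>x'. f_all B (\<lambda>y.
              f_imp \<P> (f_and (f_mem \<P> (x, y) F) (f_mem \<P> (x', y) F)) (f_eq x x')))))))"

definition f_equipotent :: "'p forcing \<Rightarrow> 'a set \<Rightarrow> 'b set \<Rightarrow> 'p sentence" where
  "f_equipotent \<P> A B = f_ex \<P> (names \<P> (A \<times> B)) (\<lambda>F. f_bij \<P> F A B)"

text \<open>\<open>|\<mu>| = \<theta>\<close> holds in the extension iff there \<open>\<mu>\<close> is equipotent with \<open>\<theta>\<close>, and \<open>\<theta>\<close> is a cardinal,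
  i.e. not equipotent with any smaller ordinal.\<close>

definition collapses :: "'p forcing \<Rightarrow> 'a rel \<Rightarrow> 'b rel \<Rightarrow> bool" where
  "collapses \<P> \<mu> \<theta> \<longleftrightarrow>
     f_and (f_equipotent \<P> (Field \<mu>) (Field \<theta>))
           (f_all (Field \<theta>) (\<lambda>\<beta>. f_not \<P> (f_equipotent \<P> (underS \<theta> \<beta>) (Field \<theta>))))
       (weakest \<P>)"


subsection \<open>Adding a generic filter\<close>

definition dense :: "'c forcing \<Rightarrow> 'c set \<Rightarrow> bool" where
  "dense \<C> D \<longleftrightarrow> D \<subseteq> conds \<C> \<and> (\<forall>c\<in>conds \<C>. \<exists>d\<in>D. le \<C> c d)"

definition f_filter :: "'p forcing \<Rightarrow> 'c forcing \<Rightarrow> ('c \<times> 'p) set \<Rightarrow> 'p sentence" where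
  "f_filter \<P> \<C> H =
     f_and (f_ex \<P> (conds \<C>) (\<lambda>c. f_mem \<P> c H))
    (f_and (f_all (conds \<C>) (\<lambda>d. f_all {c \<in> conds \<C>. le \<C> c d} (\<lambda>c.
              f_imp \<P> (f_mem \<P> d H) (f_mem \<P> c H))))
           (f_all (conds \<C>) (\<lambda>c. f_all (conds \<C>) (\<lambda>d.
              f_imp \<P> (f_and (f_mem \<P> c H) (f_mem \<P> d H))
                (f_ex \<P> {e \<in> conds \<C>. le \<C> c e \<and> le \<C> d e} (\<lambda>e. f_mem \<P> e H))))))"

text \<open>The dense sets range over the ground model, so the filter is generic over the ground model.\<close>

definition f_generic :: "'p forcing \<Rightarrow> 'c forcing \<Rightarrow> ('c \<times> 'p) set \<Rightarrow> 'p sentence" where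
  "f_generic \<P> \<C> H =
     f_and (f_filter \<P> \<C> H)
           (f_all {D. dense \<C> D} (\<lambda>D. f_ex \<P> D (\<lambda>d. f_mem \<P> d H)))"

text \<open>A sentence holds in every generic extension iff it is forced by the weakest condition.\<close>

definition adds_generic :: "'p forcing \<Rightarrow> 'c forcing \<Rightarrow> bool" where
  "adds_generic \<P> \<C> \<longleftrightarrow>
     f_ex \<P> (names \<P> (conds \<C>)) (\<lambda>H. f_generic \<P> \<C> H) (weakest \<P>)"


section \<open>The forcing orders\<close>

definition cohen :: "'k rel \<Rightarrow> ('k \<rightharpoonup> bool) forcing" where
  "cohen \<kappa> = \<lparr>conds = seqs \<kappa> UNIV, le = (\<subseteq>\<^sub>m), weakest = Map.empty\<rparr>"

definition adds_cohen_real :: "'p forcing \<Rightarrow> 'k rel \<Rightarrow> bool" where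
  "adds_cohen_real \<P> \<kappa> \<longleftrightarrow> adds_generic \<P> (cohen \<kappa>)"

definition Q1 :: "'k rel \<Rightarrow> 'k set forcing" where
  "Q1 \<kappa> = \<lparr>conds = {a. a \<subseteq> Field \<kappa> \<and> |a| =o \<kappa>}, le = (\<lambda>a b. b \<subseteq> a), weakest = Field \<kappa>\<rparr>"

definition splitting :: "'k rel \<Rightarrow> ('k \<rightharpoonup> 'k) set \<Rightarrow> ('k \<rightharpoonup> 'k) \<Rightarrow> bool" where
  "splitting \<kappa> T t \<longleftrightarrow> t \<in> T \<and> |{i \<in> Field \<kappa>. snoc \<kappa> t i \<in> T}| =o \<kappa>"

text \<open>In the last clause the sequence \<open>\<langle>t \<xi> : \<xi> < \<delta>\<rangle>\<close> is nonempty (the empty sequence has no limit; admitting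
  it would make the root of every condition splitting), and \<open>u\<close> is its union; \<open>u \<in> seqs \<kappa> (Field \<kappa>)\<close>
  is the proviso that the limit has length less than \<open>\<kappa>\<close>.\<close>

definition miller_tree :: "'k rel \<Rightarrow> ('k \<rightharpoonup> 'k) set \<Rightarrow> bool" where
  "miller_tree \<kappa> T \<longleftrightarrow>
     T \<noteq> {} \<and> T \<subseteq> seqs \<kappa> (Field \<kappa>) \<and>
     (\<forall>t\<in>T. \<forall>s\<in>seqs \<kappa> (Field \<kappa>). s \<subseteq>\<^sub>m t \<longrightarrow> s \<in> T) \<and>
     (\<forall>s\<in>T. \<exists>t. s \<subseteq>\<^sub>m t \<and> splitting \<kappa> T t) \<and>
     (\<forall>\<delta>\<in>Field \<kappa>. \<forall>t :: 'k \<Rightarrow> ('k \<rightharpoonup> 'k). \<forall>u\<in>seqs \<kappa> (Field \<kappa>).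
        underS \<kappa> \<delta> \<noteq> {} \<and>
        (\<forall>\<xi>\<in>underS \<kappa> \<delta>. splitting \<kappa> T (t \<xi>)) \<and>
        (\<forall>\<xi>\<in>underS \<kappa> \<delta>. \<forall>\<eta>\<in>underS \<kappa> \<delta>. (\<xi>, \<eta>) \<in> \<kappa> \<longrightarrow> t \<xi> \<subseteq>\<^sub>m t \<eta>) \<and>
        Map.graph u = (\<Union>\<xi>\<in>underS \<kappa> \<delta>. Map.graph (t \<xi>))
        \<longrightarrow> splitting \<kappa> T u)"

definition Q2 :: "'k rel \<Rightarrow> ('k \<rightharpoonup> 'k) set forcing" where
  "Q2 \<kappa> = \<lparr>conds = {T. miller_tree \<kappa> T}, le = (\<lambda>p q. q \<subseteq> p), weakest = seqs \<kappa> (Field \<kappa>)\<rparr>"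

end

(*
Collapsing 2^\<kappa> to \<omega> with Q1 gives a name \<sigma> for a surjection from \<omega> onto 2^\<kappa>. If a family a_i (i < 2^\<kappa>)
of conditions of Q1 is thinned recursively to b_i that decide \<sigma> up to some n_i, where the last value
decided is fresh, i.e. not decided by any earlier b_j, then each b_i is compatible with only finitely
many earlier b_j: these have n_j < n_i, with pairwise distinct n_j.

Let the index i = (T, D) run through the Miller trees T with at most 2^{<\<kappa>} nodes, which are dense in Q2,
and the dense subsets D of Cohen forcing. There are at most 2^{2^{<\<kappa>}} = 2^\<kappa> such pairs. Thinning each T
at all its splitting nodes t simultaneously, as above for the successor sets at t, gives trees S0_i. Recursively
one then finds S_i below S0_i and n_i < \<omega> such that S_i is incompatible with every earlier S_j with
n_j = n_i. Otherwise there are a decreasing sequence of trees, the k-th below S0_i and below some S_j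
with n_j = k, and an increasing sequence of splitting nodes of these trees. As cf(\<kappa>) > \<omega>, the limit of the
nodes is a splitting node of all the trees, and its successor sets contradict the finiteness above.

In an extension by Q2 the filter contains at most one S_i with n_i = n for each n. Meeting the
corresponding dense sets D one after another yields a filter that is generic because the S_i with
second index component D are dense in Q2, for every D.
*)
theory Submission
  imports Defs
begin

section \<open>Names for generic filters\<close>

lemma f_impI:
  assumes "\<And>q. q \<in> conds \<P> \<Longrightarrow> le \<P> p q \<Longrightarrow> \<phi> q \<Longrightarrow> \<exists>r\<in>conds \<P>. le \<P> q r \<and> \<psi> r"
  shows "f_imp \<P> \<phi> \<psi> p"
  using assms unfolding f_imp_def f_not_def f_and_def by blast

text \<open>For each \<open>k\<close> a generic filter of \<open>\<P>\<close> meets the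
  \<open>S i\<close> with \<open>n i = k\<close> for at most one set \<open>D i\<close>, so it
  determines an increasing sequence in \<open>\<C>\<close>: the step from \<open>k\<close> to
  \<open>k + 1\<close> moves into that dense set or stays put. The downward closure of the sequence
  is a filter, and \<open>cover\<close> makes it meet every dense set.\<close>

lemma adds_generic_if_antichains:
  fixes \<P> :: "'p forcing" and \<C> :: "'c forcing"
    and S :: "'i \<Rightarrow> 'p" and n :: "'i \<Rightarrow> nat" and D :: "'i \<Rightarrow> 'c set"
  assumes refl: "\<And>p. p \<in> conds \<P> \<Longrightarrow> le \<P> p p"
    and trans: "\<And>p q r. p \<in> conds \<P> \<Longrightarrow> q \<in> conds \<P> \<Longrightarrow> r \<in> conds \<P> \<Longrightarrow>
                   le \<P> p q \<Longrightarrow> le \<P> q r \<Longrightarrow> le \<P> p r"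
    and reflC: "\<And>c. c \<in> conds \<C> \<Longrightarrow> le \<C> c c"
    and transC: "\<And>c d e. c \<in> conds \<C> \<Longrightarrow> d \<in> conds \<C> \<Longrightarrow> e \<in> conds \<C> \<Longrightarrow>
                   le \<C> c d \<Longrightarrow> le \<C> d e \<Longrightarrow> le \<C> c e"
    and c0: "c0 \<in> conds \<C>"
    and S: "\<And>i. i \<in> I \<Longrightarrow> S i \<in> conds \<P>"
    and D: "\<And>i. i \<in> I \<Longrightarrow> dense \<C> (D i)"
    and antichain: "\<And>i j r. i \<in> I \<Longrightarrow> j \<in> I \<Longrightarrow> n i = n j \<Longrightarrow> r \<in> conds \<P> \<Longrightarrow>
                       le \<P> (S i) r \<Longrightarrow> le \<P> (S j) r \<Longrightarrow> D i = D j"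
    and cover: "\<And>p E. p \<in> conds \<P> \<Longrightarrow> dense \<C> E \<Longrightarrow> \<exists>i\<in>I. D i = E \<and> le \<P> p (S i)"
  shows "adds_generic \<P> \<C>"
proof -
  define ext where "ext E c = (SOME d. d \<in> E \<and> le \<C> c d)" for E c
  have ext: "ext E c \<in> E \<and> le \<C> c (ext E c)" if "dense \<C> E" "c \<in> conds \<C>" for E c
    using that unfolding ext_def dense_def by (metis (mono_tags, lifting) someI_ex)
  have ext_in: "ext E c \<in> conds \<C>" if "dense \<C> E" "c \<in> conds \<C>" for E c
    using ext[OF that] that(1) unfolding dense_def by blast
  \<comment> \<open>\<open>dec k p c\<close>: \<open>p\<close> decides that the increasing sequence meeting the chosen dense sets has \<open>k\<close>-th term \<open>c\<close>.
    The second alternative keeps the sequence constant at \<open>k\<close> if the filter contains no \<open>S i\<close> with \<open>n i = k\<close>.\<close>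
  define dec :: "nat \<Rightarrow> 'p \<Rightarrow> 'c \<Rightarrow> bool" where
    "dec = rec_nat (\<lambda>p c. c = c0) (\<lambda>k X p c. \<exists>c'. X p c' \<and>
       ((\<exists>i\<in>I. n i = k \<and> le \<P> (S i) p \<and> c = ext (D i) c') \<or>
        (c = c' \<and> (\<forall>i\<in>I. n i = k \<longrightarrow> \<not> (\<exists>r\<in>conds \<P>. le \<P> p r \<and> le \<P> (S i) r)))))"
  have dec_0: "dec 0 p c \<longleftrightarrow> c = c0" for p c
    by (simp add: dec_def)
  have dec_Suc: "dec (Suc k) p c \<longleftrightarrow> (\<exists>c'. dec k p c' \<and>
       ((\<exists>i\<in>I. n i = k \<and> le \<P> (S i) p \<and> c = ext (D i) c') \<or>
        (c = c' \<and> (\<forall>i\<in>I. n i = k \<longrightarrow> \<not> (\<exists>r\<in>conds \<P>. le \<P> p r \<and> le \<P> (S i) r)))))" for k p c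
    by (simp add: dec_def)
  have dec_in: "c \<in> conds \<C>" if "dec k p c" for k p c
    using that by (induction k arbitrary: c) (use c0 D ext_in in \<open>auto simp: dec_0 dec_Suc\<close>)
  have dec_mono: "dec k q c" if "dec k p c" "p \<in> conds \<P>" "q \<in> conds \<P>" "le \<P> p q" for k p q c
    using that(1)
  proof (induction k arbitrary: c)
    case (Suc k)
    then obtain c' where c': "dec k p c'" "(\<exists>i\<in>I. n i = k \<and> le \<P> (S i) p \<and> c = ext (D i) c') \<or>
        (c = c' \<and> (\<forall>i\<in>I. n i = k \<longrightarrow> \<not> (\<exists>r\<in>conds \<P>. le \<P> p r \<and> le \<P> (S i) r)))"
      unfolding dec_Suc by blast
    have "dec k q c'" using Suc.IH c'(1) .
    moreover have "le \<P> (S i) q" if "i \<in> I" "le \<P> (S i) p" for i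
      using that S trans \<open>p \<in> conds \<P>\<close> \<open>q \<in> conds \<P>\<close> \<open>le \<P> p q\<close> by blast
    moreover have "le \<P> p r" if "r \<in> conds \<P>" "le \<P> q r" for r
      using that trans \<open>p \<in> conds \<P>\<close> \<open>q \<in> conds \<P>\<close> \<open>le \<P> p q\<close> by blast
    ultimately show ?case unfolding dec_Suc using c'(2) by blast
  qed (simp add: dec_0)
  have dec_unique: "c = d" if "dec k p c" "dec k p d" "p \<in> conds \<P>" for k p c d
    using that(1,2)
  proof (induction k arbitrary: c d)
    case (Suc k)
    obtain c' where c': "dec k p c'" "(\<exists>i\<in>I. n i = k \<and> le \<P> (S i) p \<and> c = ext (D i) c') \<or>
        (c = c' \<and> (\<forall>i\<in>I. n i = k \<longrightarrow> \<not> (\<exists>r\<in>conds \<P>. le \<P> p r \<and> le \<P> (S i) r)))"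
      using Suc.prems(1) unfolding dec_Suc by blast
    obtain d' where d': "dec k p d'" "(\<exists>i\<in>I. n i = k \<and> le \<P> (S i) p \<and> d = ext (D i) d') \<or>
        (d = d' \<and> (\<forall>i\<in>I. n i = k \<longrightarrow> \<not> (\<exists>r\<in>conds \<P>. le \<P> p r \<and> le \<P> (S i) r)))"
      using Suc.prems(2) unfolding dec_Suc by blast
    have "c' = d'" using Suc.IH c'(1) d'(1) by blast
    \<comment> \<open>The two alternatives exclude each other, since \<open>p\<close> itself would
      extend both \<open>p\<close> and \<open>S i\<close>. If both decisions use the first one,
      \<open>antichain\<close> makes the dense sets equal.\<close>
    then show ?case using c'(2) d'(2) antichain that(3) refl by metis
  qed (simp add: dec_0)
  \<comment> \<open>Once the \<open>k\<close>-th term is decided, either strengthen below a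
    compatible \<open>S i\<close> with \<open>n i = k\<close>, or there is none and the second
    alternative already holds.\<close>
  have dec_ex: "\<exists>q\<in>conds \<P>. le \<P> p q \<and> (\<exists>c. dec k q c)" if "p \<in> conds \<P>" for p k
  proof (induction k)
    case 0
    then show ?case using that refl by (auto simp: dec_0)
  next
    case (Suc k)
    then obtain q c where q: "q \<in> conds \<P>" "le \<P> p q" "dec k q c" by blast
    show ?case
    proof (cases "\<exists>i\<in>I. n i = k \<and> (\<exists>r\<in>conds \<P>. le \<P> q r \<and> le \<P> (S i) r)")
      case True
      then obtain i r where i: "i \<in> I" "n i = k" "r \<in> conds \<P>" "le \<P> q r" "le \<P> (S i) r"
        by blast
      then have "dec (Suc k) r (ext (D i) c)"
        unfolding dec_Suc using dec_mono[OF q(3) q(1) i(3,4)] by blast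
      then show ?thesis using i(3,4) q(1,2) trans that by blast
    next
      case False
      then have "dec (Suc k) q c" unfolding dec_Suc using q(3) by blast
      then show ?thesis using q by blast
    qed
  qed
  have dec_incr: "le \<C> c d" if "dec k p c" "dec (k + m) p d" "p \<in> conds \<P>" for k m p c d
    using that(2)
  proof (induction m arbitrary: d)
    case 0
    then show ?case using dec_unique that reflC dec_in by fastforce
  next
    case (Suc m)
    then obtain d' where d': "dec (k + m) p d'" "(\<exists>i\<in>I. d = ext (D i) d') \<or> d = d'"
      using dec_Suc by (metis add_Suc_right)
    have "le \<C> d' d"
      using d' ext D reflC dec_in by metis
    then show ?case
      using Suc.IH[OF d'(1)] transC dec_in that(1) d'(1) Suc.prems by blast
  qed
  \<comment> \<open>\<open>A c p\<close> says that \<open>p\<close> decides some term of the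
    sequence to be at least as strong as \<open>c\<close>, so \<open>H\<close> names the downward
    closure of the sequence.\<close>
  define A where "A c p \<longleftrightarrow> c \<in> conds \<C> \<and> (\<exists>k d. dec k p d \<and> le \<C> c d)" for c p
  define H where "H = {(c, p). p \<in> conds \<P> \<and> A c p}"
  have H: "H \<in> names \<P> (conds \<C>)"
    unfolding H_def names_def A_def by auto
  have A_mono: "A c q" if "A c p" "p \<in> conds \<P>" "q \<in> conds \<P>" "le \<P> p q" for c p q
    using that dec_mono unfolding A_def by meson
  have mem: "f_mem \<P> c H p \<longleftrightarrow> dense_above \<P> p (A c)" for c p
  proof -
    have "(\<exists>s. (c, s) \<in> H \<and> le \<P> s r) \<longleftrightarrow> A c r" if "r \<in> conds \<P>" for r
      using that A_mono refl unfolding H_def by blast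
    then show ?thesis unfolding f_mem_def dense_above_def by (meson)
  qed
  have mem_A: "f_mem \<P> c H p" if "A c p" "p \<in> conds \<P>" for c p
    unfolding mem dense_above_def using that A_mono refl by meson
  have A_ex: "\<exists>q\<in>conds \<P>. le \<P> p q \<and> A c q" if "f_mem \<P> c H p" "p \<in> conds \<P>" for c p
    using that refl unfolding mem dense_above_def by blast
  have "f_generic \<P> \<C> H p" if p: "p \<in> conds \<P>" for p
    unfolding f_generic_def f_filter_def f_and_def
  proof (intro conjI)
    show "f_ex \<P> (conds \<C>) (\<lambda>c. f_mem \<P> c H) p"
      unfolding f_ex_def dense_above_def
    proof (intro ballI impI)
      fix q assume q: "q \<in> conds \<P>" "le \<P> p q"
      have "A c0 q" unfolding A_def using c0 dec_0 reflC by blast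
      then show "\<exists>r\<in>conds \<P>. le \<P> q r \<and> (\<exists>c\<in>conds \<C>. f_mem \<P> c H r)"
        using q mem_A refl c0 by blast
    qed
    show "f_all (conds \<C>) (\<lambda>d. f_all {c \<in> conds \<C>. le \<C> c d} (\<lambda>c.
              f_imp \<P> (f_mem \<P> d H) (f_mem \<P> c H))) p"
      unfolding f_all_def
    proof (intro ballI f_impI)
      fix d c q
      assume d: "d \<in> conds \<C>" "c \<in> {c \<in> conds \<C>. le \<C> c d}"
        and q: "q \<in> conds \<P>" "f_mem \<P> d H q"
      obtain r where r: "r \<in> conds \<P>" "le \<P> q r" "A d r" using A_ex q by blast
      then have "A c r" unfolding A_def using d transC dec_in by blast
      then show "\<exists>r\<in>conds \<P>. le \<P> q r \<and> f_mem \<P> c H r"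
        using r mem_A by blast
    qed
    show "f_all (conds \<C>) (\<lambda>c. f_all (conds \<C>) (\<lambda>d.
              f_imp \<P> (\<lambda>p. f_mem \<P> c H p \<and> f_mem \<P> d H p)
                (f_ex \<P> {e \<in> conds \<C>. le \<C> c e \<and> le \<C> d e} (\<lambda>e. f_mem \<P> e H)))) p"
      unfolding f_all_def
    proof (intro ballI f_impI)
      fix c d q
      assume c: "c \<in> conds \<C>" "d \<in> conds \<C>"
        and q: "q \<in> conds \<P>" "f_mem \<P> c H q \<and> f_mem \<P> d H q"
      obtain r where r: "r \<in> conds \<P>" "le \<P> q r" "A c r" using A_ex q by blast
      have "f_mem \<P> d H r"
        using q r trans unfolding mem dense_above_def by (metis (full_types))
      then obtain s where s: "s \<in> conds \<P>" "le \<P> r s" "A d s" using A_ex r by blast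
      have "A c s" using A_mono r s by blast
      obtain k c' where k: "dec k s c'" "le \<C> c c'" using \<open>A c s\<close> unfolding A_def by blast
      obtain m d' where m: "dec m s d'" "le \<C> d d'" using s(3) unfolding A_def by blast
      have "\<exists>e. A e s \<and> e \<in> conds \<C> \<and> le \<C> c e \<and> le \<C> d e"
      proof (cases "k \<le> m")
        case True
        then have "le \<C> c' d'" using dec_incr[of k s c' "m - k" d'] k m s by simp
        then show ?thesis
          using k m c dec_in transC reflC unfolding A_def by (intro exI[of _ d']) blast
      next
        case False
        then have "le \<C> d' c'" using dec_incr[of m s d' "k - m" c'] k m s by simp
        then show ?thesis
          using k m c dec_in transC reflC unfolding A_def by (intro exI[of _ c']) blast
      qed
      then obtain e where e: "A e s" "e \<in> {e \<in> conds \<C>. le \<C> c e \<and> le \<C> d e}" by blast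
      have "f_ex \<P> {e \<in> conds \<C>. le \<C> c e \<and> le \<C> d e} (\<lambda>e. f_mem \<P> e H) s"
        unfolding f_ex_def dense_above_def
        using e A_mono s(1) mem_A refl by meson
      then show "\<exists>r\<in>conds \<P>. le \<P> q r \<and>
          f_ex \<P> {e \<in> conds \<C>. le \<C> c e \<and> le \<C> d e} (\<lambda>e. f_mem \<P> e H) r"
        using s r q trans by blast
    qed
    show "f_all {D. dense \<C> D} (\<lambda>D. f_ex \<P> D (\<lambda>d. f_mem \<P> d H)) p"
      unfolding f_all_def f_ex_def dense_above_def
    proof (intro ballI impI)
      fix E q assume E: "E \<in> {D. dense \<C> D}" and q: "q \<in> conds \<P>" "le \<P> p q"
      obtain i where i: "i \<in> I" "D i = E" "le \<P> q (S i)" using cover E q by blast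
      obtain r c where r: "r \<in> conds \<P>" "le \<P> (S i) r" "dec (n i) r c"
        using dec_ex S i by meson
      \<comment> \<open>As \<open>r\<close> lies below \<open>S i\<close>, the step at
        \<open>n i\<close> moves into \<open>D i = E\<close>.\<close>
      have "dec (Suc (n i)) r (ext E c)" unfolding dec_Suc using r i by blast
      moreover have "ext E c \<in> E" "ext E c \<in> conds \<C>" using ext ext_in E dec_in r by auto
      ultimately have "A (ext E c) r" "ext E c \<in> E" unfolding A_def using reflC by blast+
      then show "\<exists>r\<in>conds \<P>. le \<P> q r \<and> (\<exists>d\<in>E. f_mem \<P> d H r)"
        using r mem_A trans q S i by blast
    qed
  qed
  then show ?thesis
    unfolding adds_generic_def f_ex_def dense_above_def using H refl by blast
qed

section \<open>Almost disjoint refinement in the forcing of large subsets\<close>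

lemma f_impD:
  assumes "f_imp \<P> \<phi> (f_eq x y) p" "q \<in> conds \<P>" "le \<P> p q" "\<phi> q"
  shows "x = y"
  using assms unfolding f_imp_def f_not_def f_and_def f_eq_def by blast

lemma f_mem_mono:
  assumes "f_mem (Q1 \<kappa>) x F p" "q \<subseteq> p"
  shows "f_mem (Q1 \<kappa>) x F q"
  using assms unfolding f_mem_def dense_above_def by (auto simp: Q1_def)

lemma card_of_finite_ordLess_infinite: "finite A \<Longrightarrow> infinite B \<Longrightarrow> |A| <o |B|"
  by (intro finite_ordLess_infinite card_of_Well_order) (simp_all add: Field_card_of)

text \<open>The relation \<open>|I|\<close> well-orders \<open>I\<close> in the least possible order
  type, so that every \<open>earlier I i\<close> has smaller cardinality than
  \<open>I\<close>.\<close>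

abbreviation earlier :: "'i set \<Rightarrow> 'i \<Rightarrow> 'i set" where
  "earlier I i \<equiv> underS |I| i"

lemma underS_card_of: "j \<in> earlier I i \<Longrightarrow> j \<in> I"
  by (auto simp: underS_def dest: FieldI1[of _ _ "|I|", unfolded Field_card_of])

text \<open>Read \<open>dec p n v\<close> as: \<open>p\<close> decides that a map on \<omega> whose
  range covers \<open>L\<close> takes the value \<open>v\<close> at \<open>n\<close>. Along
  \<open>|I|\<close>, choose \<open>b i\<close> to decide the map up to some \<open>n i\<close> at
  which its value is fresh, that is, different from all values decided by earlier
  \<open>b j\<close>. If \<open>b j\<close> and \<open>b i\<close> have their common part in
  \<open>M\<close>, they agree wherever both decide, so freshness leaves at most \<open>n i\<close>
  such \<open>j\<close>.\<close>

lemma thin_family_of_decisions: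
  fixes I :: "'i set" and L :: "'v set" and M :: "'k set set"
    and dec :: "'k set \<Rightarrow> nat \<Rightarrow> 'v \<Rightarrow> bool"
  assumes I: "|I| \<le>o |L|" "infinite L"
    and mono: "\<And>p q n v. dec p n v \<Longrightarrow> q \<subseteq> p \<Longrightarrow> dec q n v"
    and unique: "\<And>p n v w. p \<in> M \<Longrightarrow> dec p n v \<Longrightarrow> dec p n w \<Longrightarrow> v = w"
    and total: "\<And>p n. p \<in> M \<Longrightarrow> \<exists>q\<in>M. q \<subseteq> p \<and> (\<exists>v. dec q n v)"
    and onto: "\<And>p v. p \<in> M \<Longrightarrow> v \<in> L \<Longrightarrow> \<exists>q\<in>M. q \<subseteq> p \<and> (\<exists>n. dec q n v)"
    and a: "\<And>i. i \<in> I \<Longrightarrow> a i \<in> M"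
  shows "\<exists>b. \<forall>i\<in>I. b i \<in> M \<and> b i \<subseteq> a i \<and> finite {j \<in> earlier I i. b j \<inter> b i \<in> M}"
proof -
  define V :: "('i \<Rightarrow> 'k set \<times> (nat \<Rightarrow> 'v) \<times> nat) \<Rightarrow> 'i \<Rightarrow> 'v set" where
    "V g i = (\<Union>j\<in>earlier I i. fst (snd (g j)) ` {..snd (snd (g j))})" for g i
  \<comment> \<open>A triple holds the thinned set, the decided values and the last position
    decided. Nothing is required outside \<open>I\<close>, because the recursion runs over the whole
    type.\<close>
  define Q :: "('i \<Rightarrow> 'k set \<times> (nat \<Rightarrow> 'v) \<times> nat) \<Rightarrow> 'i \<Rightarrow> 'k set \<times> (nat \<Rightarrow> 'v) \<times> nat \<Rightarrow> bool" where
    "Q g i = (\<lambda>(b, e, n). i \<in> I \<longrightarrow> b \<in> M \<and> b \<subseteq> a i \<and> (\<forall>m\<le>n. dec b m (e m)) \<and>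
        e n \<notin> V g i)" for g i
  have wo: "Well_order |I|" by (simp add: card_of_Well_order)
  have "\<exists>g. \<forall>i. Q g i (g i)"
  proof (rule dependent_wf_choice)
    show "wf ( |I| - Id)" using wo unfolding well_order_on_def by blast
  next
    fix f g :: "'i \<Rightarrow> 'k set \<times> (nat \<Rightarrow> 'v) \<times> nat" and i r
    assume "\<And>j. (j, i) \<in> |I| - Id \<Longrightarrow> f j = g j"
    then have "f j = g j" if "j \<in> earlier I i" for j using that by (auto simp: underS_def)
    then have "V f i = V g i" unfolding V_def by (intro SUP_cong) auto
    then show "Q f i r = Q g i r" unfolding Q_def by simp
  next
    fix i :: 'i and g
    show "\<exists>r. Q g i r"
    proof (cases "i \<in> I")
      case True
      \<comment> \<open>There are fewer than \<open>|L|\<close> earlier stages, and each contributes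
        finitely many values.\<close>
      have "|V g i| <o |L|"
      proof -
        have u: "|earlier I i| <o |L|"
          using card_of_underS[of "|I|" i] True I(1) card_of_Card_order Field_card_of
          by (metis ordLess_ordLeq_trans)
        show ?thesis
        proof (cases "finite (earlier I i)")
          case True
          then have "finite (V g i)" by (auto simp: V_def)
          then show ?thesis using I(2) by (simp add: card_of_finite_ordLess_infinite)
        next
          case False
          have "|V g i| \<le>o |earlier I i|"
            unfolding V_def
          proof (rule card_of_UNION_ordLeq_infinite[OF False])
            show "\<forall>j\<in>earlier I i. |fst (snd (g j)) ` {..snd (snd (g j))}| \<le>o |earlier I i|"
              using False by (auto intro!: ordLess_imp_ordLeq card_of_finite_ordLess_infinite)
          qed (simp add: ordLeq_refl card_of_Card_order)
          then show ?thesis using u ordLeq_ordLess_trans by blast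
        qed
      qed
      then have "\<not> L \<subseteq> V g i"
        using card_of_mono1 not_ordLess_ordLeq by blast
      then obtain v where v: "v \<in> L" "v \<notin> V g i" by blast
      \<comment> \<open>The fresh value \<open>v\<close> is decided first, which fixes the position
        \<open>n\<close>; the finitely many positions below \<open>n\<close> follow.\<close>
      obtain q n where q: "q \<in> M" "q \<subseteq> a i" "dec q n v" using onto a True v(1) by meson
      have "\<exists>p\<in>M. p \<subseteq> q \<and> (\<exists>e. \<forall>m<k. dec p m (e m))" for k
      proof (induction k)
        case 0
        then show ?case using q by auto
      next
        case (Suc k)
        then obtain p e where p: "p \<in> M" "p \<subseteq> q" "\<forall>m<k. dec p m (e m)" by blast
        obtain p' w where p': "p' \<in> M" "p' \<subseteq> p" "dec p' k w" using total p(1) by blast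
        have "\<forall>m<Suc k. dec p' m ((e(k := w)) m)"
          using p p' mono by (auto simp: less_Suc_eq)
        then show ?case using p p' by (metis subset_trans)
      qed
      then obtain p e where p: "p \<in> M" "p \<subseteq> q" "\<forall>m<n. dec p m (e m)" by blast
      have "Q g i (p, e(n := v), n)"
        unfolding Q_def using p q v mono by (auto simp: le_less)
      then show ?thesis by blast
    next
      case False
      then show ?thesis unfolding Q_def by auto
    qed
  qed
  then obtain g where g: "\<And>i. Q g i (g i)" by blast
  define b e n where "b i = fst (g i)" and "e i = fst (snd (g i))" and "n i = snd (snd (g i))" for i
  have b: "b i \<in> M" "b i \<subseteq> a i" "\<And>m. m \<le> n i \<Longrightarrow> dec (b i) m (e i m)"
    and fresh: "\<And>j m. j \<in> earlier I i \<Longrightarrow> m \<le> n j \<Longrightarrow> e i (n i) \<noteq> e j m" if "i \<in> I" for i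
    using g[of i] that unfolding Q_def V_def b_def e_def n_def by (auto split: prod.splits)
  have "finite {j \<in> earlier I i. b j \<inter> b i \<in> M}" (is "finite ?J") if i: "i \<in> I" for i
  proof -
    \<comment> \<open>Both decisions persist to \<open>b j \<inter> b i\<close>, where
      \<open>unique\<close> identifies them.\<close>
    have J: "j \<in> I \<and> e j m = e i m" if "j \<in> ?J" "m \<le> n j" "m \<le> n i" for j m
    proof -
      have j: "j \<in> I" using that by (auto dest: underS_card_of)
      have "dec (b j \<inter> b i) m (e j m)" using b(3)[OF j that(2)] mono by blast
      moreover have "dec (b j \<inter> b i) m (e i m)" using b(3)[OF i that(3)] mono by blast
      ultimately show ?thesis using unique that(1) j by blast
    qed
    \<comment> \<open>Otherwise the fresh value \<open>e i (n i)\<close> would be among those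
      decided by \<open>b j\<close>.\<close>
    have less: "n j < n i" if "j \<in> ?J" for j
    proof (rule ccontr)
      assume "\<not> n j < n i"
      then have "e j (n i) = e i (n i)" using J[OF that, of "n i"] by simp
      then show False using fresh[OF i, of j "n i"] that \<open>\<not> n j < n i\<close> by simp
    qed
    \<comment> \<open>If \<open>n j = n j'\<close>, both agree with \<open>e i\<close> at this
      position, although the later of the two took a value fresh for the earlier.\<close>
    have "inj_on n ?J"
    proof (rule inj_onI, rule ccontr)
      fix j j' assume j: "j \<in> ?J" "j' \<in> ?J" "n j = n j'" "j \<noteq> j'"
      have "j \<in> I" "j' \<in> I" using J[OF j(1), of 0] J[OF j(2), of 0] by auto
      have eq: "e j (n j) = e j' (n j)"
        using J[OF j(1), of "n j"] J[OF j(2), of "n j"] less[OF j(1)] j(3) by simp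
      have "(j, j') \<in> |I| \<or> (j', j) \<in> |I|"
        using wo_rel.TOTALS[of "|I|"] wo \<open>j \<in> I\<close> \<open>j' \<in> I\<close> unfolding wo_rel_def Field_card_of by blast
      then have "j \<in> earlier I j' \<or> j' \<in> earlier I j" using j(4) by (auto simp: underS_def)
      then show False
        using fresh[OF \<open>j' \<in> I\<close>, of j "n j"] fresh[OF \<open>j \<in> I\<close>, of j' "n j"] eq j(3) by auto
    qed
    moreover have "finite (n ` ?J)" by (rule finite_subset[of _ "{..<n i}"]) (use less in auto)
    ultimately show ?thesis using finite_imageD by blast
  qed
  then show ?thesis using b by blast
qed

lemma Q1_conds: "a \<in> conds (Q1 \<kappa>) \<longleftrightarrow> a \<subseteq> Field \<kappa> \<and> |a| =o \<kappa>"
  by (simp add: Q1_def)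

lemma card_of_image_inj_ordIso:
  assumes "inj_on f A" "|A| =o \<kappa>"
  shows "|f ` A| =o \<kappa>"
  using assms by (meson card_of_ordIsoI inj_on_imp_bij_betw ordIso_symmetric ordIso_transitive)

text \<open>The collapse provides, below some \<open>r\<close>, a name for a bijection between
  2^\<kappa> and \<omega>, whose values are the decisions for
  \<open>thin_family_of_decisions\<close>. Two conditions are compatible iff their intersection has
  size \<kappa>.\<close>

lemma thin_family:
  fixes \<kappa> :: "'k rel" and I :: "'i set"
  assumes \<kappa>: "Cinfinite \<kappa>"
    and collapse: "collapses (Q1 \<kappa>) (ctwo ^c \<kappa>) natLeq"
    and I: "|I| \<le>o ctwo ^c \<kappa>"
    and a: "\<And>i. i \<in> I \<Longrightarrow> a i \<in> conds (Q1 \<kappa>)"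
  shows "\<exists>b. \<forall>i\<in>I. b i \<in> conds (Q1 \<kappa>) \<and> b i \<subseteq> a i \<and>
           finite {j \<in> earlier I i. |b j \<inter> b i| =o \<kappa>}"
proof -
  let ?L = "Field (ctwo ^c \<kappa>)"
  have LL: "|?L| =o ctwo ^c \<kappa>" by (simp add: card_of_Field_ordIso Card_order_cexp)
  have "Cinfinite (ctwo ^c \<kappa>)"
    using \<kappa> by (simp add: Cinfinite_cexp ordLeq_refl Card_order_ctwo)
  then have L: "infinite ?L" "|I| \<le>o |?L|"
    using LL I unfolding cinfinite_def by (auto intro: ordLeq_ordIso_trans ordIso_symmetric)
  have "Field \<kappa> \<in> conds (Q1 \<kappa>)"
    using \<kappa> by (simp add: Q1_conds card_of_Field_ordIso)
  then obtain r F where r: "r \<in> conds (Q1 \<kappa>)" and F: "f_bij (Q1 \<kappa>) F ?L (UNIV :: nat set) r"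
    using collapse unfolding collapses_def f_and_def f_equipotent_def f_ex_def dense_above_def
    by (auto simp: Q1_def Field_natLeq)
  define M where "M = {p \<in> conds (Q1 \<kappa>). p \<subseteq> r}"
  \<comment> \<open>\<open>F\<close> names a bijection from \<open>?L\<close> to the natural numbers
    and \<open>dec\<close> decides its inverse, so totality of \<open>F\<close> becomes
    \<open>onto\<close> and surjectivity becomes \<open>total\<close>.\<close>
  define dec where "dec p n v \<longleftrightarrow> v \<in> ?L \<and> f_mem (Q1 \<kappa>) (v, n) F p" for p and n :: nat and v
  have le: "le (Q1 \<kappa>) r p" if "p \<in> M" for p using that by (simp add: M_def Q1_def)
  have M: "p \<in> conds (Q1 \<kappa>)" "p \<subseteq> r" if "p \<in> M" for p using that by (auto simp: M_def)
  have le_iff: "le (Q1 \<kappa>) p q \<longleftrightarrow> q \<subseteq> p" for p q by (simp add: Q1_def)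
  have F1: "\<exists>q\<in>M. q \<subseteq> p \<and> (\<exists>n. f_mem (Q1 \<kappa>) (v, n) F q)" if pv: "p \<in> M" "v \<in> ?L" for p v
  proof -
    have "f_ex (Q1 \<kappa>) UNIV (\<lambda>n. f_mem (Q1 \<kappa>) (v, n) F) r"
      using F pv(2) unfolding f_bij_def f_and_def f_all_def by blast
    then obtain q n where "q \<in> conds (Q1 \<kappa>)" "q \<subseteq> p" "f_mem (Q1 \<kappa>) (v, n) F q"
      using M[OF pv(1)] unfolding f_ex_def dense_above_def le_iff by blast
    then show ?thesis using M[OF pv(1)] unfolding M_def by blast
  qed
  have F2: "\<exists>q\<in>M. q \<subseteq> p \<and> (\<exists>v\<in>?L. f_mem (Q1 \<kappa>) (v, n) F q)" if pv: "p \<in> M" for p n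
  proof -
    have "f_ex (Q1 \<kappa>) ?L (\<lambda>v. f_mem (Q1 \<kappa>) (v, n) F) r"
      using F unfolding f_bij_def f_and_def f_all_def by blast
    then obtain q v where "q \<in> conds (Q1 \<kappa>)" "q \<subseteq> p" "v \<in> ?L" "f_mem (Q1 \<kappa>) (v, n) F q"
      using M[OF pv] unfolding f_ex_def dense_above_def le_iff by blast
    then show ?thesis using M[OF pv] unfolding M_def by blast
  qed
  have F3: "v = w" if "p \<in> M" "v \<in> ?L" "w \<in> ?L" "f_mem (Q1 \<kappa>) (v, n) F p" "f_mem (Q1 \<kappa>) (w, n) F p"
    for p n v w
  proof -
    have "f_imp (Q1 \<kappa>) (f_and (f_mem (Q1 \<kappa>) (v, n) F) (f_mem (Q1 \<kappa>) (w, n) F)) (f_eq v w) r"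
      using F that unfolding f_bij_def f_and_def f_all_def by blast
    moreover have "f_and (f_mem (Q1 \<kappa>) (v, n) F) (f_mem (Q1 \<kappa>) (w, n) F) p"
      using that by (simp add: f_and_def)
    ultimately show ?thesis using f_impD M(1) le that(1) by metis
  qed
  \<comment> \<open>The name for the surjection is available only below \<open>r\<close>; the bijection \<open>h\<close> transports the problem there.\<close>
  obtain h where h: "bij_betw h (Field \<kappa>) r"
    using r \<kappa> by (metis Q1_conds card_of_ordIso card_of_Field_ordIso ordIso_symmetric ordIso_transitive)
  have hM: "h ` c \<in> M" if "c \<in> conds (Q1 \<kappa>)" for c
  proof -
    have "inj_on h c" using that h by (meson Q1_conds bij_betw_def inj_on_subset)
    moreover have "h ` c \<subseteq> r" using that h by (auto simp: Q1_conds bij_betw_def)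
    moreover have "|h ` c| =o \<kappa>"
      using that \<open>inj_on h c\<close> by (simp add: Q1_conds card_of_image_inj_ordIso)
    ultimately show ?thesis
      using r by (auto simp: M_def Q1_conds)
  qed
  have "\<exists>b. \<forall>i\<in>I. b i \<in> M \<and> b i \<subseteq> h ` a i \<and> finite {j \<in> earlier I i. b j \<inter> b i \<in> M}"
  proof (rule thin_family_of_decisions[OF L(2,1), where dec = dec and a = "\<lambda>i. h ` a i"])
    show "\<And>p q n v. dec p n v \<Longrightarrow> q \<subseteq> p \<Longrightarrow> dec q n v"
      unfolding dec_def by (auto intro: f_mem_mono)
    show "\<And>p n v w. p \<in> M \<Longrightarrow> dec p n v \<Longrightarrow> dec p n w \<Longrightarrow> v = w"
      unfolding dec_def by (auto intro: F3)
    show "\<And>p n. p \<in> M \<Longrightarrow> \<exists>q\<in>M. q \<subseteq> p \<and> (\<exists>v. dec q n v)"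
      unfolding dec_def using F2 by meson
    show "\<And>p v. p \<in> M \<Longrightarrow> v \<in> ?L \<Longrightarrow> \<exists>q\<in>M. q \<subseteq> p \<and> (\<exists>n. dec q n v)"
      unfolding dec_def using F1 by meson
    show "\<And>i. i \<in> I \<Longrightarrow> h ` a i \<in> M" using a hM by blast
  qed
  then obtain b where b: "\<And>i. i \<in> I \<Longrightarrow> b i \<in> M \<and> b i \<subseteq> h ` a i \<and>
      finite {j \<in> earlier I i. b j \<inter> b i \<in> M}" by blast
  have ai: "a i \<subseteq> Field \<kappa>" if "i \<in> I" for i using a that by (simp add: Q1_conds)
  \<comment> \<open>Pulling back along the injective \<open>h\<close> undoes the transport and
    respects containment and intersections of size \<kappa>.\<close>
  define b' where "b' i = {x \<in> Field \<kappa>. h x \<in> b i}" for i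
  have b'_Field: "b' i \<subseteq> Field \<kappa>" for i by (auto simp: b'_def)
  have hb': "h ` (b' i) = b i" if "i \<in> I" for i
  proof -
    have "b i \<subseteq> h ` Field \<kappa>" using b[OF that] ai[OF that] by blast
    then show ?thesis by (auto simp: b'_def)
  qed
  have inj: "inj_on h (Field \<kappa>)" using h by (simp add: bij_betw_def)
  have sub: "b' i \<subseteq> a i" if i: "i \<in> I" for i
  proof
    fix x assume x: "x \<in> b' i"
    then obtain y where "y \<in> a i" "h x = h y" using b[OF i] by (auto simp: b'_def)
    then show "x \<in> a i" using x ai[OF i] inj by (auto simp: b'_def dest: inj_onD)
  qed
  have c: "b' i \<in> conds (Q1 \<kappa>)" if "i \<in> I" for i
  proof -
    have "inj_on h (b' i)" using inj by (auto simp: b'_def inj_on_def)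
    then have "|b i| =o |b' i|"
      using card_of_image_inj_ordIso[OF _ card_of_refl] hb'[OF that] by metis
    moreover have "|b i| =o \<kappa>" using b[OF that] by (simp add: M_def Q1_conds)
    ultimately have "|b' i| =o \<kappa>" using ordIso_transitive ordIso_symmetric by metis
    then show ?thesis by (auto simp: Q1_conds b'_def)
  qed
  have "finite {j \<in> earlier I i. |b' j \<inter> b' i| =o \<kappa>}" if i: "i \<in> I" for i
  proof (rule finite_subset)
    show "{j \<in> earlier I i. |b' j \<inter> b' i| =o \<kappa>} \<subseteq> {j \<in> earlier I i. b j \<inter> b i \<in> M}"
    proof safe
      fix j assume j: "j \<in> earlier I i" "|b' j \<inter> b' i| =o \<kappa>"
      have "j \<in> I" using j(1) by (rule underS_card_of)
      have "h ` (b' j \<inter> b' i) = b j \<inter> b i"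
        using hb'[OF i] hb'[OF \<open>j \<in> I\<close>] inj_on_image_Int[OF inj] b'_Field by metis
      moreover have "b' j \<inter> b' i \<in> conds (Q1 \<kappa>)"
        using j(2) by (auto simp: Q1_conds b'_def)
      ultimately show "b j \<inter> b i \<in> M" using hM by metis
    qed
  qed (use b[OF i] in blast)
  then show ?thesis using c sub by blast
qed

section \<open>Miller trees\<close>

locale infinite_cardinal =
  fixes \<kappa> :: "'k rel"
  assumes Cinfinite: "Cinfinite \<kappa>"
begin

definition cut :: "('k \<rightharpoonup> 'b) \<Rightarrow> 'k \<Rightarrow> ('k \<rightharpoonup> 'b)" where
  "cut s x = s |` underS \<kappa> x"

definition is_chain :: "('k \<rightharpoonup> 'b) set \<Rightarrow> bool" where
  "is_chain X \<longleftrightarrow> (\<forall>s\<in>X. \<forall>t\<in>X. s \<subseteq>\<^sub>m t \<or> t \<subseteq>\<^sub>m s)"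

definition is_union :: "('k \<rightharpoonup> 'b) set \<Rightarrow> ('k \<rightharpoonup> 'b) \<Rightarrow> bool" where
  "is_union X u \<longleftrightarrow> Map.graph u = (\<Union>t\<in>X. Map.graph t)"

abbreviation succs :: "('k \<rightharpoonup> 'k) set \<Rightarrow> ('k \<rightharpoonup> 'k) \<Rightarrow> 'k set" where
  "succs T t \<equiv> {i \<in> Field \<kappa>. snoc \<kappa> t i \<in> T}"

section \<open>The well-order of the ordinals below \<kappa>\<close>

lemma Card_order: "Card_order \<kappa>" and infinite_Field: "infinite (Field \<kappa>)"
  using Cinfinite by (auto simp: cinfinite_def)

lemma wo: "wo_rel \<kappa>"
  using Card_order by (simp add: wo_rel_def card_order_on_def)

lemma underS_trans: "x \<in> underS \<kappa> y \<Longrightarrow> y \<in> underS \<kappa> z \<Longrightarrow> x \<in> underS \<kappa> z"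
  using wo_rel.TRANS[OF wo] wo_rel.ANTISYM[OF wo] unfolding underS_def
  by (auto dest: transD antisymD)

lemma underS_linear: "x \<in> Field \<kappa> \<Longrightarrow> y \<in> Field \<kappa> \<Longrightarrow> x = y \<or> x \<in> underS \<kappa> y \<or> y \<in> underS \<kappa> x"
  using wo_rel.TOTALS[OF wo] unfolding underS_def by blast

lemma underS_in_Field: "x \<in> underS \<kappa> y \<Longrightarrow> x \<in> Field \<kappa>"
  by (auto simp: underS_def Field_def)

lemma underS_not_refl: "x \<notin> underS \<kappa> x"
  by (simp add: underS_def)

lemma underS_asym: "x \<in> underS \<kappa> y \<Longrightarrow> y \<notin> underS \<kappa> x"
  using underS_trans underS_not_refl by metis

lemma underS_subset_iff:
  "x \<in> Field \<kappa> \<Longrightarrow> y \<in> Field \<kappa> \<Longrightarrow> underS \<kappa> x \<subseteq> underS \<kappa> y \<longleftrightarrow> y \<notin> underS \<kappa> x"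
  using underS_linear underS_trans underS_not_refl by blast

text \<open>Initial segments of a well-order other than the whole field have the form
  \<open>underS\<close>; the point \<open>z\<close> excludes the whole field.\<close>

lemma downset_eq_underS:
  assumes "A \<subseteq> Field \<kappa>" "\<And>x y. x \<in> A \<Longrightarrow> y \<in> underS \<kappa> x \<Longrightarrow> y \<in> A" "z \<in> Field \<kappa>" "z \<notin> A"
  shows "\<exists>x\<in>Field \<kappa>. A = underS \<kappa> x"
proof -
  have "under \<kappa> x \<subseteq> A" if "x \<in> A" for x
  proof
    fix y assume "y \<in> under \<kappa> x"
    then have "y = x \<or> y \<in> underS \<kappa> x" by (auto simp: under_def underS_def)
    then show "y \<in> A" using assms(2) that by blast
  qed
  then have "ofilter \<kappa> A"
    using assms(1) by (auto simp: ofilter_def)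
  then show ?thesis
    using wo_rel.ofilter_underS_Field[OF wo] assms(3,4) by blast
qed

section \<open>Sequences, their lengths and initial segments\<close>

lemma seqs_len:
  assumes "s \<in> seqs \<kappa> B"
  shows len_in_Field: "len \<kappa> s \<in> Field \<kappa>" and dom_eq_underS_len: "dom s = underS \<kappa> (len \<kappa> s)"
proof -
  obtain a where a: "a \<in> Field \<kappa>" "dom s = underS \<kappa> a" using assms by (auto simp: seqs_def)
  have "len \<kappa> s \<in> Field \<kappa> \<and> dom s = underS \<kappa> (len \<kappa> s)"
    unfolding len_def
    by (rule theI2[where a = a]) (use a underS_linear underS_not_refl in \<open>metis+\<close>)
  then show "len \<kappa> s \<in> Field \<kappa>" "dom s = underS \<kappa> (len \<kappa> s)" by auto
qed

lemma len_eqI: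
  assumes "a \<in> Field \<kappa>" "dom s = underS \<kappa> a"
  shows "len \<kappa> s = a"
  unfolding len_def by (rule the_equality) (use assms underS_linear underS_not_refl in \<open>metis+\<close>)

lemma dom_seqs_in_Field: "s \<in> seqs \<kappa> B \<Longrightarrow> x \<in> dom s \<Longrightarrow> x \<in> Field \<kappa>"
  using dom_eq_underS_len underS_in_Field by blast

lemma dom_seqs_downward: "s \<in> seqs \<kappa> B \<Longrightarrow> x \<in> dom s \<Longrightarrow> y \<in> underS \<kappa> x \<Longrightarrow> y \<in> dom s"
  using dom_eq_underS_len underS_trans by blast

lemma len_notin_dom: "s \<in> seqs \<kappa> B \<Longrightarrow> len \<kappa> s \<notin> dom s"
  using dom_eq_underS_len underS_not_refl by blast

lemma seqs_mono: "s \<in> seqs \<kappa> B \<Longrightarrow> a \<in> Field \<kappa> \<Longrightarrow> t \<subseteq>\<^sub>m s \<Longrightarrow> dom t = underS \<kappa> a \<Longrightarrow> t \<in> seqs \<kappa> B"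
  by (fastforce simp: seqs_def ran_def map_le_def dom_def)

lemma empty_in_seqs: "Map.empty \<in> seqs \<kappa> B"
proof -
  obtain z where "z \<in> Field \<kappa>" using infinite_Field by (metis equals0I finite.emptyI)
  then have "\<exists>x\<in>Field \<kappa>. {} = underS \<kappa> x" using downset_eq_underS[of "{}" z] by simp
  then show ?thesis by (auto simp: seqs_def)
qed

lemma cut_le: "cut s x \<subseteq>\<^sub>m s"
  by (auto simp: cut_def map_le_def)

lemma dom_cut: "s \<in> seqs \<kappa> B \<Longrightarrow> x \<in> dom s \<Longrightarrow> dom (cut s x) = underS \<kappa> x"
  unfolding cut_def dom_restrict using dom_seqs_downward by blast

lemma cut_in_seqs: "s \<in> seqs \<kappa> B \<Longrightarrow> x \<in> dom s \<Longrightarrow> cut s x \<in> seqs \<kappa> B"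
  using seqs_mono cut_le dom_cut dom_seqs_in_Field by metis

lemma len_cut: "s \<in> seqs \<kappa> B \<Longrightarrow> x \<in> dom s \<Longrightarrow> len \<kappa> (cut s x) = x"
  using len_eqI dom_cut dom_seqs_in_Field by metis

lemma map_le_dom_eq: "s \<subseteq>\<^sub>m t \<Longrightarrow> dom t \<subseteq> dom s \<Longrightarrow> s = t"
  unfolding map_le_def fun_eq_iff by (metis domIff subsetD)

lemma cut_mono:
  assumes "s \<subseteq>\<^sub>m t" "s \<in> seqs \<kappa> B" "x \<in> dom s"
  shows "cut s x = cut t x"
proof
  fix y
  show "cut s x y = cut t x y"
    using dom_seqs_downward[OF assms(2,3), of y] assms(1)
    by (auto simp: cut_def restrict_map_def map_le_def)
qed

lemma map_le_linear:
  assumes "s \<in> seqs \<kappa> B" "t \<in> seqs \<kappa> C" "s \<subseteq>\<^sub>m u" "t \<subseteq>\<^sub>m u"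
  shows "s \<subseteq>\<^sub>m t \<or> t \<subseteq>\<^sub>m s"
proof -
  have "dom s \<subseteq> dom t \<or> dom t \<subseteq> dom s"
    using assms(1,2) underS_linear underS_trans len_in_Field dom_eq_underS_len
    by (metis subsetI)
  then show ?thesis using assms(3,4) unfolding map_le_def by (metis subsetD)
qed

text \<open>Domains are initial segments, so the first ordinal missing from \<open>dom t\<close>,
  which is the length of \<open>t\<close>, belongs to the larger domain.\<close>

lemma proper_initial:
  assumes "t \<in> seqs \<kappa> B" "s \<in> seqs \<kappa> C" "t \<subseteq>\<^sub>m s" "t \<noteq> s"
  shows "len \<kappa> t \<in> dom s" "t = cut s (len \<kappa> t)"
proof -
  have "dom t \<subseteq> dom s" using assms(3) by (rule map_le_implies_dom_le)
  moreover have "\<not> dom s \<subseteq> dom t" using assms(3,4) map_le_dom_eq by blast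
  ultimately show x: "len \<kappa> t \<in> dom s"
    using underS_subset_iff len_in_Field dom_eq_underS_len assms(1,2) by metis
  have "cut s (len \<kappa> t) \<subseteq>\<^sub>m t \<or> t \<subseteq>\<^sub>m cut s (len \<kappa> t)"
    using map_le_linear[OF cut_in_seqs[OF assms(2) x] assms(1) cut_le assms(3)] by blast
  then show "t = cut s (len \<kappa> t)"
    using dom_cut[OF assms(2) x] dom_eq_underS_len[OF assms(1)] map_le_dom_eq by (metis order_refl)
qed

lemma len_mono:
  assumes "t \<in> seqs \<kappa> B" "s \<in> seqs \<kappa> C" "t \<subseteq>\<^sub>m s"
  shows "underS \<kappa> (len \<kappa> t) \<subseteq> underS \<kappa> (len \<kappa> s)"
  using map_le_implies_dom_le[OF assms(3)] dom_eq_underS_len assms(1,2) by metis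

lemma snoc_le_iff:
  assumes "t \<in> seqs \<kappa> B"
  shows "snoc \<kappa> t i \<subseteq>\<^sub>m s \<longleftrightarrow> t \<subseteq>\<^sub>m s \<and> s (len \<kappa> t) = Some i"
proof -
  have "t (len \<kappa> t) = None" using len_notin_dom[OF assms] by auto
  then show ?thesis
    by (fastforce simp: snoc_def map_le_def dom_def)
qed

lemma cut_snoc: "t \<in> seqs \<kappa> B \<Longrightarrow> cut (snoc \<kappa> t i) (len \<kappa> t) = t"
  using dom_eq_underS_len[of t B] underS_not_refl[of "len \<kappa> t"]
  by (auto simp: cut_def snoc_def restrict_map_def fun_eq_iff set_eq_iff dom_def)

text \<open>The length of \<open>s\<close> lies beyond \<open>x\<close>, so adding \<open>x\<close>
  to its predecessors still gives a proper initial segment, hence an admissible domain.\<close>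

lemma snoc_cut_in_seqs:
  assumes s: "s \<in> seqs \<kappa> B" and x: "s x = Some i"
  shows "snoc \<kappa> (cut s x) i \<in> seqs \<kappa> B"
proof -
  have xd: "x \<in> dom s" using x by blast
  have le: "snoc \<kappa> (cut s x) i \<subseteq>\<^sub>m s"
    using snoc_le_iff[OF cut_in_seqs[OF s xd]] cut_le x len_cut[OF s xd] by metis
  have d: "dom (snoc \<kappa> (cut s x) i) = insert x (underS \<kappa> x)"
    using dom_cut[OF s xd] len_cut[OF s xd] by (simp add: snoc_def)
  have "\<exists>a\<in>Field \<kappa>. insert x (underS \<kappa> x) = underS \<kappa> a"
  proof (rule downset_eq_underS)
    show "insert x (underS \<kappa> x) \<subseteq> Field \<kappa>"
      using dom_seqs_in_Field[OF s xd] underS_in_Field by blast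
    show "len \<kappa> s \<in> Field \<kappa>" using len_in_Field[OF s] .
    show "len \<kappa> s \<notin> insert x (underS \<kappa> x)"
      using len_notin_dom[OF s] xd dom_seqs_downward[OF s xd] by blast
    show "z \<in> insert x (underS \<kappa> x)" if "y \<in> insert x (underS \<kappa> x)" "z \<in> underS \<kappa> y" for y z
      using that underS_trans by (metis insertE insertI2)
  qed
  then show ?thesis using seqs_mono[OF s] le d by metis
qed

section \<open>Unions of chains of sequences\<close>

lemma is_union_iff: "is_union X u \<longleftrightarrow> (\<forall>x y. u x = Some y \<longleftrightarrow> (\<exists>t\<in>X. t x = Some y))"
  unfolding is_union_def Map.graph_def by (auto simp: set_eq_iff)

lemma is_union_le: "is_union X u \<Longrightarrow> t \<in> X \<Longrightarrow> t \<subseteq>\<^sub>m u"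
  unfolding is_union_iff map_le_def by (metis domD)

lemma is_union_dom: "is_union X u \<Longrightarrow> x \<in> dom u \<Longrightarrow> \<exists>t\<in>X. x \<in> dom t"
  unfolding is_union_iff by blast

text \<open>Comparability makes the union single-valued, and the common bound \<open>z\<close> keeps
  its length below \<kappa>.\<close>

lemma ex_union:
  assumes X: "X \<subseteq> seqs \<kappa> B" "is_chain X" and z: "z \<in> Field \<kappa>" "\<And>t. t \<in> X \<Longrightarrow> z \<notin> dom t"
  shows "\<exists>u\<in>seqs \<kappa> B. is_union X u"
proof -
  define u where "u x = (if \<exists>t\<in>X. x \<in> dom t then (SOME t. t \<in> X \<and> x \<in> dom t) x else None)" for x
  have u: "is_union X u"
    unfolding is_union_iff
  proof (intro allI iffI)
    fix x y assume "u x = Some y"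
    then have "\<exists>t\<in>X. x \<in> dom t" and e: "u x = (SOME t. t \<in> X \<and> x \<in> dom t) x"
      by (auto simp: u_def split: if_splits)
    then have "(SOME t. t \<in> X \<and> x \<in> dom t) \<in> X \<and> x \<in> dom (SOME t. t \<in> X \<and> x \<in> dom t)"
      by (intro someI_ex[of "\<lambda>t. t \<in> X \<and> x \<in> dom t"]) blast
    then show "\<exists>t\<in>X. t x = Some y" using e \<open>u x = Some y\<close> by metis
  next
    fix x y assume "\<exists>t\<in>X. t x = Some y"
    then obtain t where t: "t \<in> X" "t x = Some y" by blast
    then have "(SOME t. t \<in> X \<and> x \<in> dom t) \<in> X \<and> x \<in> dom (SOME t. t \<in> X \<and> x \<in> dom t)"
      by (intro someI_ex[of "\<lambda>t. t \<in> X \<and> x \<in> dom t"]) blast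
    moreover have "u x = (SOME t. t \<in> X \<and> x \<in> dom t) x" using t by (auto simp: u_def)
    ultimately show "u x = Some y"
      using t X(2) unfolding is_chain_def map_le_def by (metis domI)
  qed
  have "\<exists>a\<in>Field \<kappa>. dom u = underS \<kappa> a"
  proof (rule downset_eq_underS[OF _ _ z(1)])
    show "dom u \<subseteq> Field \<kappa>" using is_union_dom[OF u] X(1) dom_seqs_in_Field by blast
    show "z \<notin> dom u" using is_union_dom[OF u] z(2) by blast
    fix x y assume "x \<in> dom u" "y \<in> underS \<kappa> x"
    then obtain t where t: "t \<in> X" "y \<in> dom t"
      using is_union_dom[OF u] X(1) dom_seqs_downward by (metis subsetD)
    then show "y \<in> dom u" using map_le_implies_dom_le[OF is_union_le[OF u]] by blast
  qed
  moreover have "ran u \<subseteq> B"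
    using u X(1) unfolding is_union_iff by (fastforce simp: ran_def seqs_def)
  ultimately show ?thesis using u by (auto simp: seqs_def)
qed

lemma ex_shortest:
  assumes "X \<subseteq> seqs \<kappa> B" "t0 \<in> X"
  shows "\<exists>t\<in>X. \<forall>r\<in>X. len \<kappa> r \<notin> underS \<kappa> (len \<kappa> t)"
proof -
  have "wf (\<kappa> - Id)" by (rule wo_rel.WF[OF wo])
  then obtain l where l: "l \<in> len \<kappa> ` X" "\<And>y. (y, l) \<in> \<kappa> - Id \<Longrightarrow> y \<notin> len \<kappa> ` X"
    using wfE_min[of "\<kappa> - Id" "len \<kappa> t0" "len \<kappa> ` X"] assms(2) by blast
  then show ?thesis by (auto simp: underS_def)
qed

section \<open>Limits of splitting nodes, and subtrees with prescribed splitting\<close>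

lemma millerD:
  assumes "miller_tree \<kappa> T"
  shows "T \<noteq> {}" "T \<subseteq> seqs \<kappa> (Field \<kappa>)"
    "\<And>s t. t \<in> T \<Longrightarrow> s \<in> seqs \<kappa> (Field \<kappa>) \<Longrightarrow> s \<subseteq>\<^sub>m t \<Longrightarrow> s \<in> T"
    "\<And>s. s \<in> T \<Longrightarrow> \<exists>t. s \<subseteq>\<^sub>m t \<and> splitting \<kappa> T t"
  using assms unfolding miller_tree_def by (elim conjE, blast)+

lemma miller_limit:
  assumes "miller_tree \<kappa> T" "d \<in> Field \<kappa>" "u \<in> seqs \<kappa> (Field \<kappa>)" "underS \<kappa> d \<noteq> {}"
    "\<forall>x\<in>underS \<kappa> d. splitting \<kappa> T (f x)"
    "\<forall>x\<in>underS \<kappa> d. \<forall>y\<in>underS \<kappa> d. (x, y) \<in> \<kappa> \<longrightarrow> f x \<subseteq>\<^sub>m f y"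
    "Map.graph u = (\<Union>x\<in>underS \<kappa> d. Map.graph (f x))"
  shows "splitting \<kappa> T u"
proof -
  have "\<forall>\<delta>\<in>Field \<kappa>. \<forall>t :: 'k \<Rightarrow> ('k \<rightharpoonup> 'k). \<forall>u\<in>seqs \<kappa> (Field \<kappa>).
        underS \<kappa> \<delta> \<noteq> {} \<and> (\<forall>\<xi>\<in>underS \<kappa> \<delta>. splitting \<kappa> T (t \<xi>)) \<and>
        (\<forall>\<xi>\<in>underS \<kappa> \<delta>. \<forall>\<eta>\<in>underS \<kappa> \<delta>. (\<xi>, \<eta>) \<in> \<kappa> \<longrightarrow> t \<xi> \<subseteq>\<^sub>m t \<eta>) \<and>
        Map.graph u = (\<Union>\<xi>\<in>underS \<kappa> \<delta>. Map.graph (t \<xi>)) \<longrightarrow> splitting \<kappa> T u"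
    using assms(1) unfolding miller_tree_def by (elim conjE)
  then show ?thesis using assms(2-) by simp
qed

lemma splitting_in: "splitting \<kappa> T t \<Longrightarrow> t \<in> T"
  by (simp add: splitting_def)

lemma subset_ordIso: "A \<subseteq> B \<Longrightarrow> B \<subseteq> Field \<kappa> \<Longrightarrow> |A| =o \<kappa> \<Longrightarrow> |B| =o \<kappa>"
  unfolding ordIso_iff_ordLeq
  using ordLeq_transitive[OF _ card_of_mono1] ordLeq_ordIso_trans[OF card_of_mono1 card_of_Field_ordIso[OF Card_order]]
  by auto

lemma splitting_mono: "T' \<subseteq> T \<Longrightarrow> splitting \<kappa> T' t \<Longrightarrow> splitting \<kappa> T t"
  unfolding splitting_def
  using subset_ordIso[of "succs T' t" "succs T t"] by blast

text \<open>The definition of Miller trees speaks of sequences indexed by an ordinal; this passes to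
  arbitrary chains. For \<open>u\<close> outside \<open>X\<close>, index by the ordinals
  \<open>x\<close> in \<open>dom u\<close> and take the shortest member of \<open>X\<close> with
  \<open>x\<close> in its domain. The result is increasing and has the same union.\<close>

lemma miller_chain:
  assumes T: "miller_tree \<kappa> T" and X: "X \<noteq> {}" "is_chain X" "\<And>t. t \<in> X \<Longrightarrow> splitting \<kappa> T t"
    and u: "u \<in> seqs \<kappa> (Field \<kappa>)" "is_union X u"
  shows "splitting \<kappa> T u"
proof (cases "u \<in> X")
  case True
  then show ?thesis using X(3) by blast
next
  case False
  have X_seqs: "X \<subseteq> seqs \<kappa> (Field \<kappa>)" using X(3) splitting_in millerD(2)[OF T] by blast
  have "\<exists>t\<in>X. x \<in> dom t \<and> (\<forall>r\<in>X. x \<in> dom r \<longrightarrow> t \<subseteq>\<^sub>m r)" if x: "x \<in> dom u" for x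
  proof -
    obtain t0 where t0: "t0 \<in> {t \<in> X. x \<in> dom t}" using is_union_dom[OF u(2) x] by blast
    obtain t where t: "t \<in> X" "x \<in> dom t"
      "\<And>r. r \<in> X \<Longrightarrow> x \<in> dom r \<Longrightarrow> len \<kappa> r \<notin> underS \<kappa> (len \<kappa> t)"
      using ex_shortest[OF _ t0] X_seqs by blast
    have "t \<subseteq>\<^sub>m r" if r: "r \<in> X" "x \<in> dom r" for r
    proof -
      have "r = t" if "r \<subseteq>\<^sub>m t"
        using proper_initial(1)[of r _ t] that t(3)[OF r] r t(1) X_seqs dom_eq_underS_len by blast
      then show ?thesis using X(2) r(1) t(1) unfolding is_chain_def by (metis map_le_refl)
    qed
    then show ?thesis using t by blast
  qed
  then obtain f where f: "\<And>x. x \<in> dom u \<Longrightarrow> f x \<in> X \<and> x \<in> dom (f x) \<and> (\<forall>r\<in>X. x \<in> dom r \<longrightarrow> f x \<subseteq>\<^sub>m r)"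
    by metis
  let ?d = "len \<kappa> u"
  have d: "?d \<in> Field \<kappa>" "underS \<kappa> ?d = dom u"
    using len_in_Field[OF u(1)] dom_eq_underS_len[OF u(1)] by simp_all
  \<comment> \<open>If \<open>u\<close> were empty, every member of \<open>X\<close> would equal
    \<open>u\<close>, which is not in \<open>X\<close>.\<close>
  have "underS \<kappa> ?d \<noteq> {}"
  proof
    assume "underS \<kappa> ?d = {}"
    then have e: "dom u = {}" using d by simp
    obtain t where "t \<in> X" using X(1) by blast
    then have "t = u" using is_union_le[OF u(2)] e map_le_dom_eq by blast
    then show False using \<open>t \<in> X\<close> False by blast
  qed
  moreover have "\<forall>x\<in>underS \<kappa> ?d. splitting \<kappa> T (f x)" using f X(3) d by blast
  moreover have "\<forall>x\<in>underS \<kappa> ?d. \<forall>y\<in>underS \<kappa> ?d. (x, y) \<in> \<kappa> \<longrightarrow> f x \<subseteq>\<^sub>m f y"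
  proof (intro ballI impI)
    fix x y assume xy: "x \<in> underS \<kappa> ?d" "y \<in> underS \<kappa> ?d" "(x, y) \<in> \<kappa>"
    then have "f y \<in> X" "y \<in> dom (f y)" using f d by blast+
    moreover have "x = y \<or> x \<in> underS \<kappa> y" using xy(3) by (auto simp: underS_def)
    ultimately have "x \<in> dom (f y)" using X_seqs dom_seqs_downward by blast
    then show "f x \<subseteq>\<^sub>m f y" using f xy d \<open>f y \<in> X\<close> by blast
  qed
  moreover have "Map.graph u = (\<Union>x\<in>underS \<kappa> ?d. Map.graph (f x))"
  proof -
    have "u x = Some y \<longleftrightarrow> (\<exists>z\<in>dom u. f z x = Some y)" for x y
    proof
      assume xy: "u x = Some y"
      then have "x \<in> dom u" by blast
      then have "f x x = u x" using f is_union_le[OF u(2)] by (metis map_le_def)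
      then show "\<exists>z\<in>dom u. f z x = Some y" using xy \<open>x \<in> dom u\<close> by force
    next
      assume "\<exists>z\<in>dom u. f z x = Some y"
      then show "u x = Some y" using f u(2) unfolding is_union_iff by blast
    qed
    then show ?thesis unfolding d Map.graph_def by (auto simp: set_eq_iff)
  qed
  ultimately show ?thesis
    by (rule miller_limit[OF T d(1) u(1)])
qed

lemma millerI:
  assumes "T \<noteq> {}" "T \<subseteq> seqs \<kappa> (Field \<kappa>)"
    and "\<And>s t. t \<in> T \<Longrightarrow> s \<in> seqs \<kappa> (Field \<kappa>) \<Longrightarrow> s \<subseteq>\<^sub>m t \<Longrightarrow> s \<in> T"
    and "\<And>s. s \<in> T \<Longrightarrow> \<exists>t. s \<subseteq>\<^sub>m t \<and> splitting \<kappa> T t"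
    and lim: "\<And>X u. X \<noteq> {} \<Longrightarrow> is_chain X \<Longrightarrow> (\<And>t. t \<in> X \<Longrightarrow> splitting \<kappa> T t) \<Longrightarrow>
           u \<in> seqs \<kappa> (Field \<kappa>) \<Longrightarrow> is_union X u \<Longrightarrow> splitting \<kappa> T u"
  shows "miller_tree \<kappa> T"
  unfolding miller_tree_def
proof (intro conjI ballI allI impI)
  fix d and f :: "'k \<Rightarrow> ('k \<rightharpoonup> 'k)" and u
  assume d: "d \<in> Field \<kappa>" "u \<in> seqs \<kappa> (Field \<kappa>)" and
    "underS \<kappa> d \<noteq> {} \<and> (\<forall>\<xi>\<in>underS \<kappa> d. splitting \<kappa> T (f \<xi>)) \<and>
       (\<forall>\<xi>\<in>underS \<kappa> d. \<forall>\<eta>\<in>underS \<kappa> d. (\<xi>, \<eta>) \<in> \<kappa> \<longrightarrow> f \<xi> \<subseteq>\<^sub>m f \<eta>) \<and>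
       Map.graph u = (\<Union>\<xi>\<in>underS \<kappa> d. Map.graph (f \<xi>))"
  then have f: "underS \<kappa> d \<noteq> {}" "\<And>x. x \<in> underS \<kappa> d \<Longrightarrow> splitting \<kappa> T (f x)"
    "\<And>x y. x \<in> underS \<kappa> d \<Longrightarrow> y \<in> underS \<kappa> d \<Longrightarrow> (x, y) \<in> \<kappa> \<Longrightarrow> f x \<subseteq>\<^sub>m f y"
    "Map.graph u = (\<Union>x\<in>underS \<kappa> d. Map.graph (f x))"
    by simp_all
  have "is_chain (f ` underS \<kappa> d)"
    unfolding is_chain_def
  proof (clarsimp)
    fix x y assume xy: "x \<in> underS \<kappa> d" "y \<in> underS \<kappa> d" "\<not> f y \<subseteq>\<^sub>m f x"
    then have "(x, y) \<in> \<kappa> \<or> (y, x) \<in> \<kappa>" using wo_rel.TOTALS[OF wo] underS_in_Field by blast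
    then show "f x \<subseteq>\<^sub>m f y" using f(3) xy by blast
  qed
  then show "splitting \<kappa> T u"
    using lim[of "f ` underS \<kappa> d" u] f(1,2,4) d(2) unfolding is_union_def by auto
qed (use assms in auto)

text \<open>\<open>T'\<close> branches only at nodes of \<open>A\<close>, where it keeps exactly the
  directions in \<open>b\<close>; from any other node it follows a fixed path to a minimal element
  of \<open>A\<close> above it. Closure of \<open>A\<close> under limits yields the limit clause for
  \<open>T'\<close>. The last conclusion expresses that there is no branching outside
  \<open>A\<close>.\<close>

lemma select_tree:
  assumes T: "miller_tree \<kappa> T"
    and A: "A \<noteq> {}" "\<And>t. t \<in> A \<Longrightarrow> splitting \<kappa> T t"
    and lim: "\<And>X u. X \<noteq> {} \<Longrightarrow> X \<subseteq> A \<Longrightarrow> is_chain X \<Longrightarrow> u \<in> seqs \<kappa> (Field \<kappa>) \<Longrightarrow> is_union X u \<Longrightarrow> u \<in> A"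
    and b: "\<And>t. t \<in> A \<Longrightarrow> b t \<subseteq> succs T t" "\<And>t. t \<in> A \<Longrightarrow> |b t| =o \<kappa>"
    and ext: "\<And>t i. t \<in> A \<Longrightarrow> i \<in> b t \<Longrightarrow> \<exists>r\<in>A. snoc \<kappa> t i \<subseteq>\<^sub>m r"
  obtains T' where "miller_tree \<kappa> T'" "T' \<subseteq> T" "\<And>t. splitting \<kappa> T' t \<longleftrightarrow> t \<in> A \<and> t \<in> T'"
    "\<And>t. t \<in> A \<Longrightarrow> t \<in> T' \<Longrightarrow> succs T' t = b t"
    "\<And>s s' x. s \<in> T' \<Longrightarrow> s' \<in> T' \<Longrightarrow> x \<in> dom s \<Longrightarrow> x \<in> dom s' \<Longrightarrow> cut s x = cut s' x \<Longrightarrow>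
       cut s x \<notin> A \<Longrightarrow> s x = s' x"
proof -
  let ?S = "seqs \<kappa> (Field \<kappa>)"
  have A_T: "A \<subseteq> T" using A(2) splitting_in by blast
  have A_S: "A \<subseteq> ?S" using A_T millerD(2)[OF T] by blast
  obtain W :: "('k \<rightharpoonup> 'k) rel" where "well_order_on UNIV W" using well_order_on by blast
  then have W: "wo_rel W" "Field W = UNIV"
    unfolding wo_rel_def using well_order_on_Field well_order_on_Well_order by blast+
  define M where "M s = {t \<in> A. s \<subseteq>\<^sub>m t \<and> (\<forall>r\<in>A. s \<subseteq>\<^sub>m r \<and> r \<subseteq>\<^sub>m t \<longrightarrow> r = t)}" for s
  \<comment> \<open>Taking the least element makes the choice coherent: \<open>e s' = e s\<close> whenever \<open>s'\<close> lies between \<open>s\<close> and \<open>e s\<close>.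
    So the branches of \<open>T'\<close> that head for \<open>e s\<close> do not split before reaching it.\<close>
  define e where "e s = wo_rel.minim W (M s)" for s
  have e_M: "e s \<in> M s" if st: "t \<in> A" "s \<subseteq>\<^sub>m t" for s t
  proof -
    obtain t' where t': "t' \<in> A" "s \<subseteq>\<^sub>m t'"
      "\<And>r. r \<in> A \<Longrightarrow> s \<subseteq>\<^sub>m r \<Longrightarrow> len \<kappa> r \<notin> underS \<kappa> (len \<kappa> t')"
      using ex_shortest[of "{t \<in> A. s \<subseteq>\<^sub>m t}" "Field \<kappa>" t] st A_S by blast
    have "r = t'" if "r \<in> A" "s \<subseteq>\<^sub>m r" "r \<subseteq>\<^sub>m t'" for r
    proof (rule ccontr)
      assume "r \<noteq> t'"
      then have "len \<kappa> r \<in> dom t'" using proper_initial(1) that t'(1) A_S by blast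
      then show False using t' that A_S dom_eq_underS_len by blast
    qed
    then have "M s \<noteq> {}" using t' unfolding M_def by blast
    then show ?thesis unfolding e_def using wo_rel.minim_in[OF W(1)] W(2) by blast
  qed
  \<comment> \<open>\<open>e s\<close> still belongs to \<open>M s'\<close>, and \<open>M s'\<close>
    is contained in \<open>M s\<close>, so the least elements coincide.\<close>
  have e_eq: "e s' = e s" if s: "s' \<in> ?S" "s \<subseteq>\<^sub>m s'" "s' \<subseteq>\<^sub>m e s" "t \<in> A" "s \<subseteq>\<^sub>m t" for s s' t
  proof -
    have es: "e s \<in> A" "s \<subseteq>\<^sub>m e s" "\<And>r. r \<in> A \<Longrightarrow> s \<subseteq>\<^sub>m r \<Longrightarrow> r \<subseteq>\<^sub>m e s \<Longrightarrow> r = e s"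
      using e_M[OF s(4,5)] unfolding M_def by auto
    have "e s \<in> M s'"
      unfolding M_def using es s(3) map_le_trans[OF s(2)] by blast
    have "M s' \<subseteq> M s"
    proof
      fix t assume "t \<in> M s'"
      then have t: "t \<in> A" "s' \<subseteq>\<^sub>m t" "\<And>r. r \<in> A \<Longrightarrow> s' \<subseteq>\<^sub>m r \<Longrightarrow> r \<subseteq>\<^sub>m t \<Longrightarrow> r = t"
        unfolding M_def by auto
      have "r = t" if r: "r \<in> A" "s \<subseteq>\<^sub>m r" "r \<subseteq>\<^sub>m t" for r
      proof -
        have "r \<subseteq>\<^sub>m s' \<or> s' \<subseteq>\<^sub>m r" using map_le_linear r t(2) A_S s(1) by blast
        then show ?thesis
        proof
          assume rs: "r \<subseteq>\<^sub>m s'"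
          then have "r = e s" using es(3) r map_le_trans[OF rs s(3)] by blast
          then have "s' = r" using rs s(3) map_le_antisym by blast
          then show ?thesis using t(3) r by simp
        qed (use t(3) r in blast)
      qed
      then show "t \<in> M s" unfolding M_def using t map_le_trans[OF s(2)] by blast
    qed
    have W_all: "X \<subseteq> Field W" for X using W(2) by simp
    have "(e s, e s') \<in> W"
      unfolding e_def[of s] by (rule wo_rel.minim_least[OF W(1) W_all])
        (use \<open>M s' \<subseteq> M s\<close> \<open>e s \<in> M s'\<close> wo_rel.minim_in[OF W(1) W_all, of "M s'"] in \<open>auto simp: e_def\<close>)
    moreover have "(e s', e s) \<in> W"
      unfolding e_def[of s'] by (rule wo_rel.minim_least[OF W(1) W_all \<open>e s \<in> M s'\<close>])
    ultimately show ?thesis using wo_rel.ANTISYM[OF W(1)] by (simp add: antisymD)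
  qed
  \<comment> \<open>Whether \<open>s\<close> is good at \<open>x\<close> depends only on
    \<open>s\<close> up to and including \<open>x\<close>, which makes \<open>T'\<close> closed
    under initial segments.\<close>
  define good where "good s x \<longleftrightarrow> (if cut s x \<in> A then the (s x) \<in> b (cut s x) else s x = e (cut s x) x)" for s x
  have good_cong: "good s x \<longleftrightarrow> good s' x" if "s \<in> ?S" "x \<in> dom s" "s \<subseteq>\<^sub>m s'" for s s' x
    using that cut_mono[OF that(3,1,2)] unfolding good_def map_le_def by auto
  define T' where "T' = {s \<in> ?S. (\<exists>t\<in>A. s \<subseteq>\<^sub>m t) \<and> (\<forall>x\<in>dom s. good s x)}"
  have T'_S: "T' \<subseteq> ?S" unfolding T'_def by blast
  have T'_T: "T' \<subseteq> T" unfolding T'_def using A_T millerD(3)[OF T] by blast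
  have T'_down: "s \<in> T'" if "t \<in> T'" "s \<in> ?S" "s \<subseteq>\<^sub>m t" for s t
  proof -
    have "good s x" if "x \<in> dom s" for x
      using good_cong[of s x t] that \<open>t \<in> T'\<close> \<open>s \<in> ?S\<close> \<open>s \<subseteq>\<^sub>m t\<close> map_le_implies_dom_le[OF \<open>s \<subseteq>\<^sub>m t\<close>]
      unfolding T'_def by blast
    then show ?thesis using that map_le_trans[OF that(3)] unfolding T'_def by blast
  qed
  have succs_T': "succs T' t = b t" if t: "t \<in> A" "t \<in> T'" for t
  proof -
    have tS: "t \<in> ?S" using t A_S by blast
    have "len \<kappa> t \<in> dom (snoc \<kappa> t i)" for i by (simp add: snoc_def)
    have g: "good (snoc \<kappa> t i) (len \<kappa> t) \<longleftrightarrow> i \<in> b t" for i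
      unfolding good_def cut_snoc[OF tS] using t(1) by (simp add: snoc_def)
    have t_le: "t \<subseteq>\<^sub>m snoc \<kappa> t i" for i using snoc_le_iff[OF tS] by (metis map_le_refl)
    have "snoc \<kappa> t i \<in> T'" if i: "i \<in> b t" for i
    proof -
      have "good (snoc \<kappa> t i) x" if "x \<in> dom (snoc \<kappa> t i)" for x
      proof (cases "x \<in> dom t")
        case True
        then show ?thesis using good_cong[OF tS True t_le] t(2) unfolding T'_def by blast
      next
        case False
        then show ?thesis using that g i by (auto simp: snoc_def)
      qed
      moreover have "snoc \<kappa> t i \<in> ?S" using b(1)[OF t(1)] i millerD(2)[OF T] by blast
      ultimately show ?thesis using ext[OF t(1) i] unfolding T'_def by blast
    qed
    moreover have "i \<in> b t" if "snoc \<kappa> t i \<in> T'" for i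
      using that g \<open>len \<kappa> t \<in> dom (snoc \<kappa> t i)\<close> unfolding T'_def by blast
    ultimately show ?thesis using b(1)[OF t(1)] by auto
  qed
  have splitting_T': "splitting \<kappa> T' t \<longleftrightarrow> t \<in> A \<and> t \<in> T'" for t
  proof
    assume t: "splitting \<kappa> T' t"
    then have "t \<in> T'" by (rule splitting_in)
    then have tS: "t \<in> ?S" using T'_S by blast
    have "t \<in> A"
    proof (rule ccontr)
      assume "t \<notin> A"
      \<comment> \<open>Outside \<open>A\<close> the only direction is the one towards
        \<open>e t\<close>, so \<open>t\<close> would have at most one successor.\<close>
      have "Some i = e t (len \<kappa> t)" if "snoc \<kappa> t i \<in> T'" for i
      proof -
        have "good (snoc \<kappa> t i) (len \<kappa> t)" using that unfolding T'_def by (auto simp: snoc_def)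
        then show ?thesis unfolding good_def cut_snoc[OF tS] using \<open>t \<notin> A\<close> by (simp add: snoc_def)
      qed
      then have "succs T' t \<subseteq> {the (e t (len \<kappa> t))}" by (auto, metis option.sel)
      then have "finite (succs T' t)" using finite_subset by blast
      moreover have "infinite (succs T' t)"
        using t infinite_Field card_of_ordIso_finite_Field[OF Card_order] ordIso_symmetric
        unfolding splitting_def by blast
      ultimately show False by blast
    qed
    then show "t \<in> A \<and> t \<in> T'" using \<open>t \<in> T'\<close> by blast
  next
    assume "t \<in> A \<and> t \<in> T'"
    then show "splitting \<kappa> T' t" using succs_T' b(2) unfolding splitting_def by metis
  qed
  \<comment> \<open>By minimality no node from \<open>s\<close> up to but excluding
    \<open>e s\<close> lies in \<open>A\<close>, and \<open>e\<close> is constant on these nodes by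
    \<open>e_eq\<close>; hence the remaining positions of \<open>e s\<close> are good.\<close>
  have e_T': "e s \<in> T'" "e s \<in> A" "s \<subseteq>\<^sub>m e s" if s: "s \<in> T'" for s
  proof -
    obtain t where t: "t \<in> A" "s \<subseteq>\<^sub>m t" using s unfolding T'_def by blast
    have es: "e s \<in> A" "s \<subseteq>\<^sub>m e s" "\<And>r. r \<in> A \<Longrightarrow> s \<subseteq>\<^sub>m r \<Longrightarrow> r \<subseteq>\<^sub>m e s \<Longrightarrow> r = e s"
      using e_M[OF t] unfolding M_def by auto
    have sS: "s \<in> ?S" and esS: "e s \<in> ?S" using s T'_S es(1) A_S by auto
    have "good (e s) x" if x: "x \<in> dom (e s)" for x
    proof (cases "x \<in> dom s")
      case True
      then show ?thesis using good_cong[OF sS True es(2)] s unfolding T'_def by blast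
    next
      case False
      let ?r = "cut (e s) x"
      have r: "?r \<in> ?S" "?r \<subseteq>\<^sub>m e s" "dom ?r = underS \<kappa> x"
        using cut_in_seqs[OF esS x] cut_le dom_cut[OF esS x] by auto
      have "s \<subseteq>\<^sub>m ?r"
      proof -
        have "dom s \<subseteq> underS \<kappa> x"
          using False dom_eq_underS_len[OF sS] underS_subset_iff[OF len_in_Field[OF sS] dom_seqs_in_Field[OF esS x]]
          by simp
        then show ?thesis
          using map_le_linear[OF sS r(1) es(2) r(2)] r(3) map_le_dom_eq by (metis map_le_refl)
      qed
      have "?r \<notin> A"
        using es(3) \<open>s \<subseteq>\<^sub>m ?r\<close> r x underS_not_refl by metis
      moreover have "e ?r = e s" using e_eq[OF r(1) \<open>s \<subseteq>\<^sub>m ?r\<close> r(2) t] .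
      ultimately show ?thesis unfolding good_def by simp
    qed
    then show "e s \<in> T'" "e s \<in> A" "s \<subseteq>\<^sub>m e s"
      unfolding T'_def using es esS map_le_refl by blast+
  qed
  have "miller_tree \<kappa> T'"
  proof (rule millerI)
    obtain t where "t \<in> A" using A(1) by blast
    then have "Map.empty \<in> T'" unfolding T'_def using empty_in_seqs by auto
    then show "T' \<noteq> {}" by blast
    show "T' \<subseteq> ?S" by (rule T'_S)
    show "\<And>s t. t \<in> T' \<Longrightarrow> s \<in> ?S \<Longrightarrow> s \<subseteq>\<^sub>m t \<Longrightarrow> s \<in> T'" by (rule T'_down)
    show "\<exists>t. s \<subseteq>\<^sub>m t \<and> splitting \<kappa> T' t" if "s \<in> T'" for s
      using e_T'[OF that] splitting_T' by blast
    fix X u assume X: "X \<noteq> {}" "is_chain X" "\<And>t. t \<in> X \<Longrightarrow> splitting \<kappa> T' t" and u: "u \<in> ?S" "is_union X u"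
    have "u \<in> A" using lim[OF X(1) _ X(2) u] X(3) splitting_T' by blast
    moreover have "good u x" if x: "x \<in> dom u" for x
    proof -
      obtain t where t: "t \<in> X" "x \<in> dom t" using is_union_dom[OF u(2) x] by blast
      then have "t \<in> T'" using X(3) splitting_in by blast
      then show ?thesis
        using good_cong[of t x u] t is_union_le[OF u(2) t(1)] unfolding T'_def by blast
    qed
    ultimately have "u \<in> T'" unfolding T'_def using u map_le_refl by blast
    then show "splitting \<kappa> T' u" using \<open>u \<in> A\<close> splitting_T' by blast
  qed
  moreover have "s x = s' x" if "s \<in> T'" "s' \<in> T'" "x \<in> dom s" "x \<in> dom s'" "cut s x = cut s' x" "cut s x \<notin> A"
    for s s' x
  proof -
    have "good s x" "good s' x" using that unfolding T'_def by blast+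
    then show ?thesis using that unfolding good_def by simp
  qed
  ultimately show thesis using that T'_T splitting_T' succs_T' by blast
qed

lemma splitting_in_seqs: "miller_tree \<kappa> T \<Longrightarrow> splitting \<kappa> T t \<Longrightarrow> t \<in> seqs \<kappa> (Field \<kappa>)"
  using millerD(2) splitting_in by blast

lemma ex_splitting_above_snoc:
  assumes "miller_tree \<kappa> T" "splitting \<kappa> T t" "i \<in> succs T t"
  obtains r where "splitting \<kappa> T r" "snoc \<kappa> t i \<subseteq>\<^sub>m r" "t \<subseteq>\<^sub>m r"
proof -
  obtain r where r: "snoc \<kappa> t i \<subseteq>\<^sub>m r" "splitting \<kappa> T r" using millerD(4)[OF assms(1)] assms(3) by blast
  moreover have "t \<subseteq>\<^sub>m r" using snoc_le_iff[OF splitting_in_seqs[OF assms(1,2)]] r(1) by blast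
  ultimately show thesis using that by blast
qed

text \<open>With all splitting nodes as \<open>A\<close>, the successor sets are thinned
  simultaneously. This is how almost disjoint sets enter the trees.\<close>

lemma thin_tree:
  assumes T: "miller_tree \<kappa> T"
    and b: "\<And>t. splitting \<kappa> T t \<Longrightarrow> b t \<subseteq> succs T t" "\<And>t. splitting \<kappa> T t \<Longrightarrow> |b t| =o \<kappa>"
  obtains T' where "miller_tree \<kappa> T'" "T' \<subseteq> T" "\<And>t. splitting \<kappa> T' t \<Longrightarrow> succs T' t = b t"
proof -
  note T' = that
  show thesis
  proof (rule select_tree[OF T, of "{t. splitting \<kappa> T t}" b])
    show "{t. splitting \<kappa> T t} \<noteq> {}" using millerD(1,4)[OF T] by blast
    show "u \<in> {t. splitting \<kappa> T t}" if "X \<noteq> {}" "X \<subseteq> {t. splitting \<kappa> T t}" "is_chain X"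
      "u \<in> seqs \<kappa> (Field \<kappa>)" "is_union X u" for X u
      using miller_chain[OF T that(1,3) _ that(4,5)] that(2) by blast
    show "\<exists>r\<in>{t. splitting \<kappa> T t}. snoc \<kappa> t i \<subseteq>\<^sub>m r" if "t \<in> {t. splitting \<kappa> T t}" "i \<in> b t" for t i
      using millerD(4)[OF T] b(1) that by blast
    show thesis if "miller_tree \<kappa> T'" "T' \<subseteq> T"
      "\<And>t. splitting \<kappa> T' t \<longleftrightarrow> t \<in> {t. splitting \<kappa> T t} \<and> t \<in> T'"
      "\<And>t. t \<in> {t. splitting \<kappa> T t} \<Longrightarrow> t \<in> T' \<Longrightarrow> succs T' t = b t" for T'
      using that by (intro T'[of T']) simp_all
  qed (use b in auto)
qed

text \<open>Taking as \<open>A\<close> the splitting nodes above \<open>t\<close>, with all their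
  successors, suppresses any other splitting.\<close>

lemma tree_above:
  assumes T: "miller_tree \<kappa> T" and t: "t \<in> T"
  obtains T' where "miller_tree \<kappa> T'" "T' \<subseteq> T" "\<And>r. splitting \<kappa> T' r \<Longrightarrow> t \<subseteq>\<^sub>m r"
proof -
  note T' = that
  show thesis
  proof (rule select_tree[OF T, of "{r. splitting \<kappa> T r \<and> t \<subseteq>\<^sub>m r}" "succs T"])
    show "{r. splitting \<kappa> T r \<and> t \<subseteq>\<^sub>m r} \<noteq> {}" using millerD(4)[OF T t] by blast
    show "u \<in> {r. splitting \<kappa> T r \<and> t \<subseteq>\<^sub>m r}" if X: "X \<noteq> {}" "X \<subseteq> {r. splitting \<kappa> T r \<and> t \<subseteq>\<^sub>m r}"
      "is_chain X" "u \<in> seqs \<kappa> (Field \<kappa>)" "is_union X u" for X u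
    proof -
      obtain r where r: "r \<in> X" using X(1) by blast
      then have "t \<subseteq>\<^sub>m u" using X(2) map_le_trans is_union_le[OF X(5) r] by blast
      moreover have "splitting \<kappa> T u" using miller_chain[OF T X(1,3) _ X(4,5)] X(2) by blast
      ultimately show ?thesis by blast
    qed
    show "\<exists>s\<in>{r. splitting \<kappa> T r \<and> t \<subseteq>\<^sub>m r}. snoc \<kappa> r i \<subseteq>\<^sub>m s"
      if r: "r \<in> {r. splitting \<kappa> T r \<and> t \<subseteq>\<^sub>m r}" "i \<in> succs T r" for r i
    proof -
      have "splitting \<kappa> T r" "t \<subseteq>\<^sub>m r" using r(1) by auto
      obtain s where "splitting \<kappa> T s" "snoc \<kappa> r i \<subseteq>\<^sub>m s" "r \<subseteq>\<^sub>m s"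
        using ex_splitting_above_snoc[OF T \<open>splitting \<kappa> T r\<close> r(2)] .
      then show ?thesis using map_le_trans[OF \<open>t \<subseteq>\<^sub>m r\<close>] by blast
    qed
    show "\<And>t'. t' \<in> {r. splitting \<kappa> T r \<and> t \<subseteq>\<^sub>m r} \<Longrightarrow> |succs T t'| =o \<kappa>"
      by (simp add: splitting_def)
    show thesis if "miller_tree \<kappa> T'" "T' \<subseteq> T"
      "\<And>r. splitting \<kappa> T' r \<longleftrightarrow> r \<in> {r. splitting \<kappa> T r \<and> t \<subseteq>\<^sub>m r} \<and> r \<in> T'" for T'
      using that by (intro T'[of T']) simp_all
  qed auto
qed

section \<open>Long splitting nodes and small subtrees\<close>

lemma graph_subset_iff: "Map.graph s \<subseteq> Map.graph t \<longleftrightarrow> s \<subseteq>\<^sub>m t"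
  unfolding Map.graph_def map_le_def by (auto simp: subset_iff dom_def)

lemma infinite_if_ordIso: "|A| =o \<kappa> \<Longrightarrow> infinite A"
  using infinite_Field card_of_ordIso_finite_Field[OF Card_order] ordIso_symmetric by blast

text \<open>If \<open>z\<close> bounded the lengths of the splitting nodes above \<open>s\<close>,
  chains of them would have splitting unions, and Zorn's lemma would give a maximal one. But every
  splitting node has a proper splitting extension.\<close>

lemma ex_long_splitting:
  assumes T: "miller_tree \<kappa> T" and s: "s \<in> T" and z: "z \<in> Field \<kappa>"
  shows "\<exists>t. splitting \<kappa> T t \<and> s \<subseteq>\<^sub>m t \<and> z \<in> dom t"
proof (rule ccontr)
  assume short: "\<not> ?thesis"
  define F where "F = Map.graph ` {t. splitting \<kappa> T t \<and> s \<subseteq>\<^sub>m t}"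
  have "\<exists>M\<in>F. \<forall>X\<in>F. M \<subseteq> X \<longrightarrow> X = M"
  proof (rule subset_Zorn_nonempty)
    show "F \<noteq> {}" using millerD(4)[OF T s] unfolding F_def by blast
    fix C assume C: "C \<noteq> {}" "subset.chain F C"
    define X where "X = {t. splitting \<kappa> T t \<and> s \<subseteq>\<^sub>m t \<and> Map.graph t \<in> C}"
    have CX: "C = Map.graph ` X"
      using C(2) unfolding X_def F_def subset.chain_def by auto
    have "X \<noteq> {}" using C(1) CX by blast
    have "is_chain X"
      using C(2) unfolding is_chain_def X_def subset.chain_def graph_subset_iff[symmetric] by blast
    have "X \<subseteq> seqs \<kappa> (Field \<kappa>)" using splitting_in_seqs[OF T] unfolding X_def by blast
    moreover have "z \<notin> dom t" if "t \<in> X" for t using that short unfolding X_def by blast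
    ultimately obtain u where u: "u \<in> seqs \<kappa> (Field \<kappa>)" "is_union X u"
      using ex_union \<open>is_chain X\<close> z by blast
    have "splitting \<kappa> T u"
      using miller_chain[OF T \<open>X \<noteq> {}\<close> \<open>is_chain X\<close> _ u] unfolding X_def by blast
    moreover obtain t where "t \<in> X" using \<open>X \<noteq> {}\<close> by blast
    then have "s \<subseteq>\<^sub>m u" using is_union_le[OF u(2)] map_le_trans unfolding X_def by blast
    moreover have "\<Union>C = Map.graph u" using u(2) CX unfolding is_union_def by simp
    ultimately show "\<Union>C \<in> F" unfolding F_def by blast
  qed
  then obtain t where t: "splitting \<kappa> T t" "s \<subseteq>\<^sub>m t"
    and t_max: "\<And>r. splitting \<kappa> T r \<Longrightarrow> s \<subseteq>\<^sub>m r \<Longrightarrow> t \<subseteq>\<^sub>m r \<Longrightarrow> Map.graph r = Map.graph t"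
    unfolding F_def graph_subset_iff[symmetric] by auto
  have "succs T t \<noteq> {}"
    using t(1) infinite_if_ordIso unfolding splitting_def by (metis finite.emptyI)
  then obtain i where "i \<in> succs T t" by blast
  then obtain r where r: "splitting \<kappa> T r" "snoc \<kappa> t i \<subseteq>\<^sub>m r" "t \<subseteq>\<^sub>m r"
    using ex_splitting_above_snoc[OF T t(1)] by blast
  then have "r \<subseteq>\<^sub>m t" using t_max map_le_trans[OF t(2)] graph_subset_iff by blast
  then have "r = t" using r(3) map_le_antisym by blast
  then show False
    using r(2) snoc_le_iff[OF splitting_in_seqs[OF T t(1)]] len_notin_dom[OF splitting_in_seqs[OF T t(1)]]
    by blast
qed

lemma diff_ordIso:
  assumes "|A| =o \<kappa>" "|B| <o \<kappa>" "A \<subseteq> Field \<kappa>"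
  shows "|A - B| =o \<kappa>"
proof -
  have "|A - B| \<le>o \<kappa>"
    using card_of_mono1[of "A - B" A] assms(1) ordLeq_ordIso_trans by blast
  moreover have "\<not> |A - B| <o \<kappa>"
  proof
    assume "|A - B| <o \<kappa>"
    then have "|(A - B) \<union> B| <o \<kappa>"
      using card_of_Un_ordLess_infinite_Field infinite_Field Card_order assms(2) by blast
    moreover have "|A| \<le>o |(A - B) \<union> B|" by (rule card_of_mono1) blast
    ultimately have "|A| <o \<kappa>" using ordLeq_ordLess_trans by blast
    then show False using assms(1) not_ordLess_ordIso by blast
  qed
  ultimately show ?thesis using ordLeq_iff_ordLess_or_ordIso by blast
qed

text \<open>Each ordinal below \<kappa> is coded by the constant function of that length.\<close>

lemma Field_ordLeq_seqs: "|Field \<kappa>| \<le>o |seqs \<kappa> (UNIV :: bool set)|"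
proof -
  let ?f = "\<lambda>x y. if y \<in> underS \<kappa> x then Some True else None"
  have dom_f: "dom (?f x) = underS \<kappa> x" for x by (auto simp: dom_def)
  have "inj_on ?f (Field \<kappa>)"
  proof (rule inj_onI)
    fix x y assume xy: "x \<in> Field \<kappa>" "y \<in> Field \<kappa>" "?f x = ?f y"
    have "underS \<kappa> x = underS \<kappa> y" using arg_cong[OF xy(3), of dom] by (simp only: dom_f)
    then show "x = y" using underS_linear[OF xy(1,2)] underS_not_refl by blast
  qed
  moreover have "?f ` Field \<kappa> \<subseteq> seqs \<kappa> UNIV"
    using dom_f unfolding seqs_def by blast
  ultimately show ?thesis using card_of_ordLeq by blast
qed

lemma wf_proper_initial: "wf {(r, t). r \<in> seqs \<kappa> B \<and> t \<in> seqs \<kappa> B \<and> r \<subseteq>\<^sub>m t \<and> r \<noteq> t}"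
proof (rule wf_subset)
  show "wf (inv_image (\<kappa> - Id) (len \<kappa>))" using wo_rel.WF[OF wo] by (rule wf_inv_image)
  show "{(r, t). r \<in> seqs \<kappa> B \<and> t \<in> seqs \<kappa> B \<and> r \<subseteq>\<^sub>m t \<and> r \<noteq> t} \<subseteq> inv_image (\<kappa> - Id) (len \<kappa>)"
  proof clarify
    fix r t assume rt: "r \<in> seqs \<kappa> B" "t \<in> seqs \<kappa> B" "r \<subseteq>\<^sub>m t" "r \<noteq> t"
    then have "len \<kappa> r \<in> underS \<kappa> (len \<kappa> t)"
      using proper_initial(1)[OF rt] dom_eq_underS_len[OF rt(2)] by simp
    then show "(r, t) \<in> inv_image (\<kappa> - Id) (len \<kappa>)" by (auto simp: underS_def)
  qed
qed

text \<open>The subtree is built so that the choices which a splitting node \<open>t\<close> makes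
  at earlier splitting nodes are increasing ordinals below its length, and their set determines
  \<open>t\<close>. So there are at most 2^{<\<kappa>} splitting nodes, and any node is an initial
  segment of one of them.\<close>

lemma small_subtree:
  assumes T: "miller_tree \<kappa> T"
  obtains T' where "miller_tree \<kappa> T'" "T' \<subseteq> T" "|T'| \<le>o |seqs \<kappa> (UNIV :: bool set)|"
proof -
  let ?S = "seqs \<kappa> (Field \<kappa>)"
  define R where "R = {(r, t). r \<in> ?S \<and> t \<in> ?S \<and> r \<subseteq>\<^sub>m t \<and> r \<noteq> t}"
  \<comment> \<open>We keep only splitting nodes whose earlier choices are bounded by their length, and below let the
    choices increase. Then such a node \<open>t\<close> can be recovered from the set of its choices, a subset of \<open>len \<kappa> t\<close>.
    For singular \<open>\<kappa>\<close> the choices need not be bounded otherwise.\<close>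
  have "\<exists>act. \<forall>t. act t = (splitting \<kappa> T t \<and> (\<forall>r. (r, t) \<in> R \<and> act r \<longrightarrow> the (t (len \<kappa> r)) \<in> underS \<kappa> (len \<kappa> t)))"
    by (rule dependent_wf_choice[where R = R]) (use wf_proper_initial in \<open>auto simp: R_def\<close>)
  then obtain act where act: "\<And>t. act t \<longleftrightarrow> splitting \<kappa> T t \<and>
      (\<forall>r. (r, t) \<in> R \<and> act r \<longrightarrow> the (t (len \<kappa> r)) \<in> underS \<kappa> (len \<kappa> t))" by blast
  define A where "A = {t. act t}"
  have A_split: "splitting \<kappa> T t" if "t \<in> A" for t using that act unfolding A_def by blast
  have A_S: "t \<in> ?S" if "t \<in> A" for t using A_split[OF that] splitting_in_seqs[OF T] by blast
  have A_less: "the (t (len \<kappa> r)) \<in> underS \<kappa> (len \<kappa> t)"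
    if "t \<in> A" "r \<in> A" "r \<subseteq>\<^sub>m t" "r \<noteq> t" for r t
    using that A_S act unfolding A_def R_def by blast
  have A_I: "t \<in> A" if "splitting \<kappa> T t"
    "\<And>r. r \<in> A \<Longrightarrow> r \<subseteq>\<^sub>m t \<Longrightarrow> r \<noteq> t \<Longrightarrow> the (t (len \<kappa> r)) \<in> underS \<kappa> (len \<kappa> t)" for t
    using that act[of t] unfolding A_def R_def by blast
  \<comment> \<open>Suppose no node of \<open>A\<close> extends \<open>s\<close>. The choices of
    \<open>s\<close> at nodes of \<open>A\<close> lie below the length of \<open>s\<close> with at
    most one exception, the choice at the last such node. With this choice as \<open>z\<close> (or
    the length of \<open>s\<close> if there is no exception), every splitting node above
    \<open>s\<close> longer than \<open>z\<close> is in \<open>A\<close>.\<close>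
  have A_ext: "\<exists>t\<in>A. s \<subseteq>\<^sub>m t" if s: "s \<in> T" for s
  proof (cases "\<exists>t\<in>A. s \<subseteq>\<^sub>m t")
    case False
    have sS: "s \<in> ?S" using s millerD(2)[OF T] by blast
    have "\<exists>z\<in>Field \<kappa>. \<forall>r\<in>A. r \<subseteq>\<^sub>m s \<longrightarrow>
        the (s (len \<kappa> r)) = z \<or> the (s (len \<kappa> r)) \<in> underS \<kappa> (len \<kappa> s)"
    proof (cases "\<exists>r\<in>A. r \<subseteq>\<^sub>m s \<and> the (s (len \<kappa> r)) \<notin> underS \<kappa> (len \<kappa> s)")
      case True
      then obtain r0 where r0: "r0 \<in> A" "r0 \<subseteq>\<^sub>m s" "the (s (len \<kappa> r0)) \<notin> underS \<kappa> (len \<kappa> s)" by blast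
      have neq: "r \<noteq> s" if "r \<in> A" for r using that False map_le_refl by blast
      have r0d: "len \<kappa> r0 \<in> dom s" using proper_initial(1)[OF A_S[OF r0(1)] sS r0(2) neq[OF r0(1)]] .
      have "the (s (len \<kappa> r0)) \<in> Field \<kappa>"
        using r0d sS by (auto simp: seqs_def ran_def)
      moreover have "the (s (len \<kappa> r)) = the (s (len \<kappa> r0)) \<or> the (s (len \<kappa> r)) \<in> underS \<kappa> (len \<kappa> s)"
        if r: "r \<in> A" "r \<subseteq>\<^sub>m s" for r
      proof -
        \<comment> \<open>Of two nodes of \<open>A\<close> below \<open>s\<close>, the choice at the
          shorter is bounded by the length of the longer.\<close>
        have between: "the (s (len \<kappa> p)) \<in> underS \<kappa> (len \<kappa> s)"
          if p: "p \<in> A" "q \<in> A" "p \<subseteq>\<^sub>m q" "p \<noteq> q" "q \<subseteq>\<^sub>m s" for p q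
        proof -
          have "len \<kappa> p \<in> dom q" using proper_initial(1)[OF A_S[OF p(1)] A_S[OF p(2)] p(3,4)] .
          then have "s (len \<kappa> p) = q (len \<kappa> p)" using p(5) unfolding map_le_def by simp
          then have "the (s (len \<kappa> p)) \<in> underS \<kappa> (len \<kappa> q)" using A_less[OF p(2,1,3,4)] by simp
          then show ?thesis using len_mono[OF A_S[OF p(2)] sS p(5)] by blast
        qed
        show ?thesis
          using map_le_linear[OF A_S[OF r(1)] A_S[OF r0(1)] r(2) r0(2)] between[of r r0] between[of r0 r] r r0
          by metis
      qed
      ultimately show ?thesis by blast
    next
      case False
      then show ?thesis using len_in_Field[OF sS] by blast
    qed
    then obtain z where z: "z \<in> Field \<kappa>" "\<And>r. r \<in> A \<Longrightarrow> r \<subseteq>\<^sub>m s \<Longrightarrow>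
        the (s (len \<kappa> r)) = z \<or> the (s (len \<kappa> r)) \<in> underS \<kappa> (len \<kappa> s)" by blast
    obtain t where t: "splitting \<kappa> T t" "s \<subseteq>\<^sub>m t" "z \<in> dom t" using ex_long_splitting[OF T s z(1)] by blast
    have tS: "t \<in> ?S" using splitting_in_seqs[OF T t(1)] .
    have "t \<in> A"
    proof (rule A_I[OF t(1)])
      fix r assume r: "r \<in> A" "r \<subseteq>\<^sub>m t" "r \<noteq> t"
      then have "r \<subseteq>\<^sub>m s" "r \<noteq> s"
        using map_le_linear[OF A_S[OF r(1)] sS r(2) t(2)] False map_le_refl by blast+
      then have "s (len \<kappa> r) = t (len \<kappa> r)"
        using proper_initial(1)[OF A_S[OF r(1)] sS] t(2) unfolding map_le_def by blast
      then show "the (t (len \<kappa> r)) \<in> underS \<kappa> (len \<kappa> t)"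
        using z(2)[OF r(1) \<open>r \<subseteq>\<^sub>m s\<close>] t(3) dom_eq_underS_len[OF tS] len_mono[OF sS tS t(2)] by auto
    qed
    then show ?thesis using t(2) by blast
  qed
  \<comment> \<open>Discarding directions below the length of \<open>t\<close> makes each choice
    exceed all earlier ones and costs fewer than \<kappa> directions.\<close>
  define b where "b t = succs T t - underS \<kappa> (len \<kappa> t)" for t
  obtain T' where T': "miller_tree \<kappa> T'" "T' \<subseteq> T" "\<And>t. splitting \<kappa> T' t \<longleftrightarrow> t \<in> A \<and> t \<in> T'"
    and succs_T': "\<And>t. t \<in> A \<Longrightarrow> t \<in> T' \<Longrightarrow> succs T' t = b t"
    and unique: "\<And>s s' x. s \<in> T' \<Longrightarrow> s' \<in> T' \<Longrightarrow> x \<in> dom s \<Longrightarrow> x \<in> dom s' \<Longrightarrow> cut s x = cut s' x \<Longrightarrow>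
       cut s x \<notin> A \<Longrightarrow> s x = s' x"
  proof (rule select_tree[OF T, of A b])
    show "A \<noteq> {}" using millerD(1)[OF T] A_ext by blast
    show "splitting \<kappa> T t" if "t \<in> A" for t using A_split[OF that] .
    show "b t \<subseteq> succs T t" for t unfolding b_def by blast
    show "|b t| =o \<kappa>" if "t \<in> A" for t
      unfolding b_def
    proof (rule diff_ordIso)
      show "|succs T t| =o \<kappa>" using A_split[OF that] unfolding splitting_def by blast
      show "|underS \<kappa> (len \<kappa> t)| <o \<kappa>"
        using card_of_underS[OF Card_order] len_in_Field[OF A_S[OF that]] .
    qed blast
    show "\<exists>r\<in>A. snoc \<kappa> t i \<subseteq>\<^sub>m r" if "i \<in> b t" for t i
      using that A_ext unfolding b_def by blast
    fix X u assume X: "X \<noteq> {}" "X \<subseteq> A" "is_chain X" and u: "u \<in> ?S" "is_union X u"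
    show "u \<in> A"
    proof (rule A_I)
      show "splitting \<kappa> T u" using miller_chain[OF T X(1,3) _ u] X(2) A_split by blast
      fix r assume r: "r \<in> A" "r \<subseteq>\<^sub>m u" "r \<noteq> u"
      have rd: "len \<kappa> r \<in> dom u" using proper_initial(1)[OF A_S[OF r(1)] u(1) r(2,3)] .
      \<comment> \<open>The choice at \<open>r\<close> already occurs in some \<open>t\<close> of
        the chain, whose length bounds it and is at most that of \<open>u\<close>.\<close>
      obtain t where t: "t \<in> X" "len \<kappa> r \<in> dom t" using is_union_dom[OF u(2) rd] by blast
      have tu: "t \<subseteq>\<^sub>m u" and tA: "t \<in> A" using is_union_le[OF u(2) t(1)] t(1) X(2) by auto
      have "r \<noteq> t" using t(2) len_notin_dom[OF A_S[OF r(1)]] by blast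
      moreover have "\<not> t \<subseteq>\<^sub>m r"
        using t(2) len_notin_dom[OF A_S[OF r(1)]] map_le_implies_dom_le by blast
      then have "r \<subseteq>\<^sub>m t" using map_le_linear[OF A_S[OF r(1)] A_S[OF tA] r(2) tu] by blast
      ultimately have "the (t (len \<kappa> r)) \<in> underS \<kappa> (len \<kappa> t)" using A_less[OF tA r(1)] by blast
      moreover have "t (len \<kappa> r) = u (len \<kappa> r)" using t(2) tu unfolding map_le_def by simp
      ultimately show "the (u (len \<kappa> r)) \<in> underS \<kappa> (len \<kappa> u)"
        using len_mono[OF A_S[OF tA] u(1) tu] by auto
    qed
  qed auto
  have T'_S: "T' \<subseteq> ?S" using millerD(2)[OF T'(1)] .
  have T'_b: "the (t x) \<in> Field \<kappa>" "the (t x) \<notin> underS \<kappa> x"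
    if t: "t \<in> T'" "x \<in> dom t" "cut t x \<in> A" for t x
  proof -
    have tS: "t \<in> ?S" using t T'_S by blast
    obtain i where i: "t x = Some i" using t(2) by blast
    then have iF: "i \<in> Field \<kappa>" using tS by (auto simp: seqs_def ran_def)
    have l: "len \<kappa> (cut t x) = x" using len_cut[OF tS t(2)] .
    have "snoc \<kappa> (cut t x) i \<subseteq>\<^sub>m t"
      using snoc_le_iff[OF cut_in_seqs[OF tS t(2)]] cut_le i l by metis
    then have "snoc \<kappa> (cut t x) i \<in> T'"
      using millerD(3)[OF T'(1) t(1)] snoc_cut_in_seqs[OF tS i] by blast
    moreover have "cut t x \<in> T'"
      using millerD(3)[OF T'(1) t(1) cut_in_seqs[OF tS t(2)] cut_le] .
    ultimately have "i \<in> b (cut t x)" using succs_T'[OF t(3)] iF by blast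
    then show "the (t x) \<in> Field \<kappa>" "the (t x) \<notin> underS \<kappa> x" using i iF l unfolding b_def by auto
  qed
  \<comment> \<open>\<open>chi t\<close> is the characteristic function, on the length of
    \<open>t\<close>, of the set of choices of \<open>t\<close> at nodes of
    \<open>A\<close>.\<close>
  define chi where "chi t x = (if x \<in> underS \<kappa> (len \<kappa> t)
      then Some (\<exists>r\<in>A. r \<subseteq>\<^sub>m t \<and> r \<noteq> t \<and> the (t (len \<kappa> r)) = x) else None)" for t x
  have dom_chi: "dom (chi t) = underS \<kappa> (len \<kappa> t)" for t
    unfolding chi_def by (auto simp: dom_def)
  have chi_S: "chi t \<in> seqs \<kappa> UNIV" if "t \<in> A" for t
    using dom_chi len_in_Field[OF A_S[OF that]] unfolding seqs_def by blast
  have chi_inj: "inj_on chi (A \<inter> T')"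
  proof (rule inj_onI, rule ccontr)
    fix t t' assume t: "t \<in> A \<inter> T'" "t' \<in> A \<inter> T'" and eq: "chi t = chi t'" and "t \<noteq> t'"
    have tS: "t \<in> ?S" "t' \<in> ?S" using t A_S by auto
    have "underS \<kappa> (len \<kappa> t) = underS \<kappa> (len \<kappa> t')" using dom_chi eq by metis
    then have d: "dom t = dom t'" using dom_eq_underS_len tS by metis
    then have "\<exists>x. x \<in> dom t \<and> t x \<noteq> t' x"
      using \<open>t \<noteq> t'\<close> by (metis domIff ext)
    then obtain x where x: "x \<in> dom t" "t x \<noteq> t' x"
      and least: "\<And>y. (y, x) \<in> \<kappa> - Id \<Longrightarrow> y \<notin> {x. x \<in> dom t \<and> t x \<noteq> t' x}"
      using wfE_min[OF wo_rel.WF[OF wo], of _ "{x. x \<in> dom t \<and> t x \<noteq> t' x}"] by blast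
    have cut_eq: "cut t x = cut t' x"
    proof
      fix y
      show "cut t x y = cut t' x y"
      proof (cases "y \<in> underS \<kappa> x")
        case True
        then have "t y = t' y"
          using least[of y] dom_seqs_downward[OF tS(1) x(1)] by (auto simp: underS_def)
        then show ?thesis by (simp add: cut_def restrict_map_def)
      qed (simp add: cut_def restrict_map_def)
    qed
    define r where "r = cut t x"
    have x': "x \<in> dom t'" using x(1) d by simp
    \<comment> \<open>\<open>T'\<close> branches only at nodes of \<open>A\<close>, so the common
      part before the first difference \<open>x\<close> is in \<open>A\<close>.\<close>
    have rA: "r \<in> A" using unique[of t t' x] x x' cut_eq t unfolding r_def by blast
    have rl: "len \<kappa> r = x" unfolding r_def using len_cut[OF tS(1) x(1)] .
    \<comment> \<open>The choice of \<open>p\<close> at \<open>r\<close> is also made by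
      \<open>q\<close>, at some \<open>r'\<close>. Choices before \<open>r\<close> lie below
      \<open>x\<close> and this one does not, so \<open>r'\<close> comes after \<open>r\<close>, and
      the choice of \<open>q\<close> at \<open>r\<close> is smaller. By symmetry each of the two
      choices would be below the other.\<close>
    have key: "the (q x) \<in> underS \<kappa> (the (p x))"
      if p: "p \<in> A \<inter> T'" "q \<in> A \<inter> T'" "x \<in> dom p" "x \<in> dom q" "p x \<noteq> q x" "cut p x = r" "cut q x = r"
        and chi: "chi p = chi q" for p q
    proof -
      have pS: "p \<in> ?S" "q \<in> ?S" using p A_S by auto
      have rp: "r \<subseteq>\<^sub>m p" "r \<noteq> p" and rq: "r \<subseteq>\<^sub>m q" "r \<noteq> q"
        using p cut_le rl len_notin_dom pS by metis+
      have "the (p x) \<in> underS \<kappa> (len \<kappa> p)" using A_less[of p r] p(1) rA rp rl by blast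
      then have "chi p (the (p x)) = Some True"
        unfolding chi_def using rA rp rl by auto
      then have "chi q (the (p x)) = Some True" using chi by simp
      then obtain r' where r': "r' \<in> A" "r' \<subseteq>\<^sub>m q" "r' \<noteq> q" "the (q (len \<kappa> r')) = the (p x)"
        unfolding chi_def by (auto split: if_splits)
      have "r' \<noteq> r" using r'(4) rl p(3-5) by auto
      have "\<not> r' \<subseteq>\<^sub>m r"
      proof
        assume le: "r' \<subseteq>\<^sub>m r"
        then have "len \<kappa> r' \<in> dom r" using proper_initial(1)[OF A_S[OF r'(1)] A_S[OF rA]] \<open>r' \<noteq> r\<close> by blast
        then have "r (len \<kappa> r') = q (len \<kappa> r')" using rq(1) unfolding map_le_def by blast
        then have "the (p x) \<in> underS \<kappa> x" using A_less[OF rA r'(1) le \<open>r' \<noteq> r\<close>] r'(4) rl by simp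
        then show False using T'_b(2)[of p x] p rA by blast
      qed
      then have le: "r \<subseteq>\<^sub>m r'" using map_le_linear[OF A_S[OF rA] A_S[OF r'(1)] rq(1) r'(2)] by blast
      have xr': "x \<in> dom r'" using proper_initial(1)[OF A_S[OF rA] A_S[OF r'(1)] le] \<open>r' \<noteq> r\<close> rl by auto
      then have "r' x = q x" using r'(2) unfolding map_le_def by blast
      then have 1: "the (q x) \<in> underS \<kappa> (len \<kappa> r')" using A_less[OF r'(1) rA le] \<open>r' \<noteq> r\<close> rl by auto
      have y: "len \<kappa> r' \<in> dom q" "r' = cut q (len \<kappa> r')"
        using proper_initial[OF A_S[OF r'(1)] pS(2) r'(2,3)] by auto
      have "the (p x) \<in> Field \<kappa>" "the (p x) \<notin> underS \<kappa> (len \<kappa> r')"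
        using T'_b[of q "len \<kappa> r'"] p(2) y r'(1,4) by auto
      then show ?thesis
        using 1 underS_linear[of "the (p x)" "len \<kappa> r'"] len_in_Field[OF A_S[OF r'(1)]] underS_trans by metis
    qed
    have c: "cut t x = r" "cut t' x = r" using cut_eq by (simp_all add: r_def)
    have "the (t' x) \<in> underS \<kappa> (the (t x))" using key[OF t x(1) x' x(2) c eq] .
    moreover have "the (t x) \<in> underS \<kappa> (the (t' x))" using key[OF t(2,1) x' x(1) x(2)[symmetric] c(2,1) eq[symmetric]] .
    ultimately show False using underS_asym by blast
  qed
  have "\<exists>t\<in>A \<inter> T'. s \<subseteq>\<^sub>m t" if "s \<in> T'" for s
    using millerD(4)[OF T'(1) that] T'(3) by blast
  \<comment> \<open>A node \<open>s\<close> is recovered from a splitting extension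
    \<open>g s\<close> and its own length.\<close>
  then obtain g where g: "\<And>s. s \<in> T' \<Longrightarrow> g s \<in> A \<inter> T' \<and> s \<subseteq>\<^sub>m g s" by metis
  let ?h = "\<lambda>s. (chi (g s), len \<kappa> s)"
  let ?B = "seqs \<kappa> (UNIV :: bool set)"
  have "inj_on ?h T'"
  proof (rule inj_onI)
    fix s s' assume s: "s \<in> T'" "s' \<in> T'" "?h s = ?h s'"
    then have "g s = g s'" using chi_inj g by (auto dest: inj_onD)
    then have "s \<subseteq>\<^sub>m g s" "s' \<subseteq>\<^sub>m g s" using g[OF s(1)] g[OF s(2)] by auto
    moreover have sS: "s \<in> ?S" "s' \<in> ?S" using s T'_S by auto
    ultimately have "s \<subseteq>\<^sub>m s' \<or> s' \<subseteq>\<^sub>m s" using map_le_linear by blast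
    moreover have "dom s = dom s'" using dom_eq_underS_len[OF sS(1)] dom_eq_underS_len[OF sS(2)] s(3) by simp
    ultimately show "s = s'" using map_le_dom_eq by (metis order_refl)
  qed
  moreover have "?h ` T' \<subseteq> ?B \<times> Field \<kappa>"
    using g chi_S len_in_Field T'_S by blast
  ultimately have "|T'| \<le>o |?B \<times> Field \<kappa>|" using card_of_ordLeq[of T' "?B \<times> Field \<kappa>"] by blast
  moreover have "|?B \<times> Field \<kappa>| \<le>o |?B|"
  proof (rule card_of_Times_ordLeq_infinite_Field)
    show "infinite (Field |?B| )"
      unfolding Field_card_of using Field_ordLeq_seqs infinite_Field card_of_ordLeq_infinite by blast
  qed (simp_all add: Field_ordLeq_seqs card_of_Card_order ordLeq_refl)
  ultimately show thesis using that[OF T'(1,2)] ordLeq_transitive by blast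
qed

section \<open>From almost disjoint successor sets to countably many antichains\<close>

lemma uncountable_cofinality_bound:
  assumes cof: "natLeq <o cofinality \<kappa>"
  shows "\<exists>z\<in>Field \<kappa>. \<forall>n :: nat. z \<notin> underS \<kappa> (l n)"
proof (rule ccontr)
  assume unbounded: "\<not> ?thesis"
  let ?P = "\<lambda>A. A \<subseteq> Field \<kappa> \<and> cofinal A \<kappa> \<and> (\<forall>B. B \<subseteq> Field \<kappa> \<and> cofinal B \<kappa> \<longrightarrow> |A| \<le>o |B| )"
  let ?L = "range l \<inter> Field \<kappa>"
  have L: "cofinal ?L \<kappa>"
    unfolding cofinal_def
  proof
    fix a assume "a \<in> Field \<kappa>"
    then obtain n where "a \<in> underS \<kappa> (l n)" using unbounded by blast
    then show "\<exists>b\<in>?L. a \<noteq> b \<and> (a, b) \<in> \<kappa>" by (auto simp: underS_def Field_def)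
  qed
  \<comment> \<open>A cofinal set of least size exists, so the choice in \<open>cofinality\<close>
    does return one.\<close>
  have "\<exists>A. ?P A"
    using exists_minim_Card_order[of "card_of ` {A. A \<subseteq> Field \<kappa> \<and> cofinal A \<kappa>}"] L
    by (auto simp: card_of_Card_order)
  then have "?P (SOME A. ?P A)" by (rule someI_ex)
  then have "cofinality \<kappa> \<le>o |?L|" unfolding cofinality_def using L by blast
  moreover have "|?L| \<le>o natLeq"
  proof -
    have "|?L| \<le>o |range l|" by (rule card_of_mono1) blast
    moreover have "|range l| \<le>o |UNIV :: nat set|" by (rule card_of_image)
    ultimately show ?thesis using card_of_nat ordLeq_ordIso_trans ordLeq_transitive by blast
  qed
  ultimately show False using cof not_ordLess_ordLeq ordLeq_transitive by blast
qed

text \<open>The pairs \<open>(S i, n i)\<close> are chosen recursively. If all pairs fail at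
  \<open>i\<close>, then for every \<open>n\<close>, each Miller subtree of \<open>S0 i\<close>
  contains one that lies in an earlier \<open>S j\<close> with \<open>n j = n\<close>. Iterating
  over all \<open>n\<close> gives a node \<open>u\<close> at which \<open>S0 i\<close> shares
  \<kappa> many successors with infinitely many \<open>S0 j\<close>, against
  \<open>fin\<close>.\<close>

lemma antichain_refinement:
  fixes I :: "'i set" and S0 :: "'i \<Rightarrow> ('k \<rightharpoonup> 'k) set"
  assumes cof: "natLeq <o cofinality \<kappa>"
    and S0: "\<And>i. i \<in> I \<Longrightarrow> miller_tree \<kappa> (S0 i)"
    and fin: "\<And>i t. i \<in> I \<Longrightarrow> splitting \<kappa> (S0 i) t \<Longrightarrow>
      finite {j \<in> earlier I i. splitting \<kappa> (S0 j) t \<and> |succs (S0 j) t \<inter> succs (S0 i) t| =o \<kappa>}"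
  obtains S and n :: "'i \<Rightarrow> nat" where "\<And>i. i \<in> I \<Longrightarrow> miller_tree \<kappa> (S i)" "\<And>i. i \<in> I \<Longrightarrow> S i \<subseteq> S0 i"
    "\<And>i j R. i \<in> I \<Longrightarrow> j \<in> I \<Longrightarrow> n i = n j \<Longrightarrow> miller_tree \<kappa> R \<Longrightarrow> R \<subseteq> S i \<Longrightarrow> R \<subseteq> S j \<Longrightarrow> i = j"
proof -
  define P :: "('i \<Rightarrow> ('k \<rightharpoonup> 'k) set \<times> nat) \<Rightarrow> 'i \<Rightarrow> ('k \<rightharpoonup> 'k) set \<times> nat \<Rightarrow> bool" where
    "P f i = (\<lambda>(S, n). i \<in> I \<longrightarrow> miller_tree \<kappa> S \<and> S \<subseteq> S0 i \<and>
       (\<forall>j\<in>earlier I i. snd (f j) = n \<longrightarrow> \<not> (\<exists>R. miller_tree \<kappa> R \<and> R \<subseteq> S \<and> R \<subseteq> fst (f j))))" for f i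
  have "\<exists>f. \<forall>i. P f i (f i)"
  proof (rule dependent_wf_choice)
    show "wf ( |I| - Id)" using card_of_well_order_on unfolding well_order_on_def by blast
  next
    fix f g :: "'i \<Rightarrow> ('k \<rightharpoonup> 'k) set \<times> nat" and i r
    assume "\<And>j. (j, i) \<in> |I| - Id \<Longrightarrow> f j = g j"
    then have "f j = g j" if "j \<in> earlier I i" for j using that by (auto simp: underS_def)
    then show "P f i r = P g i r" unfolding P_def by (auto split: prod.splits)
  next
    fix i and f :: "'i \<Rightarrow> ('k \<rightharpoonup> 'k) set \<times> nat"
    assume "\<And>j. (j, i) \<in> |I| - Id \<Longrightarrow> P f j (f j)"
    then have f: "fst (f j) \<subseteq> S0 j" if "j \<in> earlier I i" for j
      using that underS_card_of[OF that] unfolding P_def by (fastforce simp: underS_def split: prod.splits)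
    show "\<exists>r. P f i r"
    proof (rule ccontr)
      assume no: "\<not> ?thesis"
      then have "i \<in> I" unfolding P_def by auto
      have hit: "\<exists>j\<in>earlier I i. snd (f j) = n \<and> (\<exists>R. miller_tree \<kappa> R \<and> R \<subseteq> S \<and> R \<subseteq> fst (f j))"
        if "miller_tree \<kappa> S" "S \<subseteq> S0 i" for S n
      proof -
        have "\<not> P f i (S, n)" using no by blast
        then show ?thesis using that unfolding P_def by auto
      qed
      \<comment> \<open>Step \<open>n\<close> moves into an earlier tree of number \<open>n\<close>,
        so distinct steps use distinct \<open>j\<close>, while the nodes grow.\<close>
      let ?Q = "\<lambda>n (S, t) (S', t'). S' \<subseteq> S \<and> t \<subseteq>\<^sub>m t' \<and> (\<exists>j\<in>earlier I i. snd (f j) = n \<and> S' \<subseteq> fst (f j))"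
      have "\<exists>h. \<forall>n. (\<lambda>(S, t). miller_tree \<kappa> S \<and> S \<subseteq> S0 i \<and> splitting \<kappa> S t) (h n) \<and> ?Q n (h n) (h (Suc n))"
      proof (rule dependent_nat_choice)
        have "\<exists>t. splitting \<kappa> (S0 i) t" using millerD(1,4)[OF S0[OF \<open>i \<in> I\<close>]] by blast
        then show "\<exists>x. (\<lambda>(S, t). miller_tree \<kappa> S \<and> S \<subseteq> S0 i \<and> splitting \<kappa> S t) x"
          using S0[OF \<open>i \<in> I\<close>] by auto
      next
        fix x and n :: nat
        assume "(\<lambda>(S, t). miller_tree \<kappa> S \<and> S \<subseteq> S0 i \<and> splitting \<kappa> S t) x"
        then obtain S t where x: "x = (S, t)" "miller_tree \<kappa> S" "S \<subseteq> S0 i" "splitting \<kappa> S t" by auto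
        \<comment> \<open>Passing first to the part above \<open>t\<close> ensures that any
          splitting node found later extends \<open>t\<close>.\<close>
        obtain S1 where S1: "miller_tree \<kappa> S1" "S1 \<subseteq> S" "\<And>r. splitting \<kappa> S1 r \<Longrightarrow> t \<subseteq>\<^sub>m r"
          by (rule tree_above[OF x(2) splitting_in[OF x(4)]]) blast
        have "S1 \<subseteq> S0 i" using S1(2) x(3) by blast
        then obtain j R where R: "j \<in> earlier I i" "snd (f j) = n" "miller_tree \<kappa> R" "R \<subseteq> S1" "R \<subseteq> fst (f j)"
          using hit[OF S1(1)] by meson
        obtain r where r: "splitting \<kappa> R r" using millerD(1,4)[OF R(3)] by blast
        then have "t \<subseteq>\<^sub>m r" using S1(3) splitting_mono[OF R(4)] by blast
        then show "\<exists>y. (\<lambda>(S, t). miller_tree \<kappa> S \<and> S \<subseteq> S0 i \<and> splitting \<kappa> S t) y \<and> ?Q n x y"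
          using R r S1(2) x(1,3) by (intro exI[of _ "(R, r)"]) auto
      qed
      then obtain h where "\<And>n. (\<lambda>(S, t). miller_tree \<kappa> S \<and> S \<subseteq> S0 i \<and> splitting \<kappa> S t) (h n) \<and> ?Q n (h n) (h (Suc n))"
        by blast
      then have h: "miller_tree \<kappa> (fst (h n))" "fst (h n) \<subseteq> S0 i" "splitting \<kappa> (fst (h n)) (snd (h n))"
        "fst (h (Suc n)) \<subseteq> fst (h n)" "snd (h n) \<subseteq>\<^sub>m snd (h (Suc n))"
        "\<exists>j\<in>earlier I i. snd (f j) = n \<and> fst (h (Suc n)) \<subseteq> fst (f j)" for n
        by (simp_all add: case_prod_unfold)
      from h(6) obtain j where j: "\<And>n. j n \<in> earlier I i" "\<And>n. snd (f (j n)) = n"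
        "\<And>n. fst (h (Suc n)) \<subseteq> fst (f (j n))" by metis
      define S t where "S n = fst (h n)" and "t n = snd (h n)" for n
      have S_mono: "S m \<subseteq> S n" if "n \<le> m" for n m
        unfolding S_def by (rule lift_Suc_antimono_le[where f = "\<lambda>n. fst (h n)", OF h(4) that])
      have t_mono: "t n \<subseteq>\<^sub>m t m" if "n \<le> m" for n m
        using that by (induction m rule: dec_induct) (use h(5) map_le_trans in \<open>auto simp: t_def\<close>)
      have t_S: "t n \<in> seqs \<kappa> (Field \<kappa>)" for n
        using splitting_in_seqs[OF h(1,3)] unfolding t_def .
      \<comment> \<open>Uncountable cofinality bounds the lengths of the countably many nodes, so
        their union still has length below \<kappa>.\<close>
      obtain z where z: "z \<in> Field \<kappa>" "\<And>n. z \<notin> dom (t n)"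
        using uncountable_cofinality_bound[OF cof, of "\<lambda>n. len \<kappa> (t n)"] dom_eq_underS_len[OF t_S] by auto
      have t_chain: "is_chain (t ` N)" for N
        unfolding is_chain_def using t_mono by (auto) (metis nle_le)
      obtain u where u: "u \<in> seqs \<kappa> (Field \<kappa>)" "is_union (range t) u"
      proof -
        have "range t \<subseteq> seqs \<kappa> (Field \<kappa>)" using t_S by blast
        moreover have "z \<notin> dom r" if "r \<in> range t" for r using that z(2) by blast
        ultimately have "\<exists>u\<in>seqs \<kappa> (Field \<kappa>). is_union (range t) u"
          using t_chain z(1) by (intro ex_union)
        then show thesis using that by blast
      qed
      \<comment> \<open>From index \<open>k\<close> on the nodes split in \<open>S k\<close>, and
        this tail has the same union.\<close>
      have split_u: "splitting \<kappa> (S k) u" for k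
      proof (rule miller_chain[OF _ _ t_chain _ u(1)])
        show "miller_tree \<kappa> (S k)" unfolding S_def by (rule h(1))
        show "t ` {k..} \<noteq> {}" by simp
        show "splitting \<kappa> (S k) r" if "r \<in> t ` {k..}" for r
          using that splitting_mono[OF S_mono] h(3) unfolding S_def t_def by auto
        have "(\<exists>m. t m x = Some y) \<longleftrightarrow> (\<exists>m\<ge>k. t m x = Some y)" for x y
        proof
          assume "\<exists>m. t m x = Some y"
          then obtain m where m: "t m x = Some y" by blast
          then have "t (max m k) x = Some y" using t_mono[of m "max m k"] unfolding map_le_def by force
          then show "\<exists>m\<ge>k. t m x = Some y" by (meson max.cobounded2)
        qed blast
        then show "is_union (t ` {k..}) u" using u(2) unfolding is_union_iff by auto
      qed
      \<comment> \<open>\<open>S (Suc n)\<close> is contained in \<open>S0 (j n)\<close> and in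
        \<open>S0 i\<close>, so both share its \<kappa> many successors of \<open>u\<close>.\<close>
      have "range j \<subseteq> {j \<in> earlier I i. splitting \<kappa> (S0 j) u \<and> |succs (S0 j) u \<inter> succs (S0 i) u| =o \<kappa>}"
      proof (clarsimp, intro conjI)
        fix n
        have Sj: "S (Suc n) \<subseteq> S0 (j n)" using j(3) f[OF j(1)] unfolding S_def by blast
        have Si: "S (Suc n) \<subseteq> S0 i" using h(2) unfolding S_def .
        show "j n \<in> earlier I i" by (rule j(1))
        show "splitting \<kappa> (S0 (j n)) u" using splitting_mono[OF Sj split_u] .
        show "|succs (S0 (j n)) u \<inter> succs (S0 i) u| =o \<kappa>"
          by (rule subset_ordIso[of "succs (S (Suc n)) u"])
            (use Sj Si split_u[of "Suc n"] in \<open>auto simp: splitting_def\<close>)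
      qed
      moreover have "splitting \<kappa> (S0 i) u" using splitting_mono[OF _ split_u] h(2) unfolding S_def by blast
      ultimately have "finite (range j)" using fin[OF \<open>i \<in> I\<close>] finite_subset by blast
      moreover have "inj j" using j(2) by (metis injI)
      ultimately show False using finite_imageD[of j UNIV] infinite_UNIV_nat by blast
    qed
  qed
  then obtain f where f: "\<And>i. P f i (f i)" by blast
  define S n where "S i = fst (f i)" and "n i = snd (f i)" for i
  have S: "miller_tree \<kappa> (S i)" "S i \<subseteq> S0 i"
    and anti: "\<And>j R. j \<in> earlier I i \<Longrightarrow> n j = n i \<Longrightarrow> miller_tree \<kappa> R \<Longrightarrow> R \<subseteq> S i \<Longrightarrow> \<not> R \<subseteq> S j"
    if "i \<in> I" for i
    using f[of i] that unfolding P_def S_def n_def by (auto simp: case_prod_unfold)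
  have "i = j" if "i \<in> I" "j \<in> I" "n i = n j" "miller_tree \<kappa> R" "R \<subseteq> S i" "R \<subseteq> S j" for i j R
  proof -
    have "(i, j) \<in> |I| \<or> (j, i) \<in> |I|"
      using wo_rel.TOTALS[of "|I|"] card_of_Well_order that(1,2) unfolding wo_rel_def Field_card_of by blast
    then have "i = j \<or> i \<in> earlier I j \<or> j \<in> earlier I i" by (auto simp: underS_def)
    then show ?thesis using anti that by metis
  qed
  then show thesis using that[of S n] S by blast
qed

section \<open>Counting the indices\<close>

lemma card_of_Pow_ctwo: "|Pow A| =o ctwo ^c |A|"
  by (simp add: cexp_def ctwo_def Field_card_of card_of_Pow_Func)

text \<open>A node is coded by its graph, a subset of \<kappa> \<times> \<kappa>.\<close>

lemma card_seqs_Field: "|seqs \<kappa> (Field \<kappa>)| \<le>o ctwo ^c \<kappa>"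
proof -
  have "inj_on Map.graph (seqs \<kappa> (Field \<kappa>))"
    by (rule inj_onI) (metis graph_subset_iff map_le_antisym order_refl)
  moreover have "Map.graph ` seqs \<kappa> (Field \<kappa>) \<subseteq> Pow (Field \<kappa> \<times> Field \<kappa>)"
  proof clarify
    fix s x y assume s: "s \<in> seqs \<kappa> (Field \<kappa>)" and "(x, y) \<in> Map.graph s"
    then have "s x = Some y" by (simp add: in_graphD)
    then show "x \<in> Field \<kappa> \<and> y \<in> Field \<kappa>"
      using s dom_seqs_in_Field[OF s] by (auto simp: seqs_def ran_def)
  qed
  ultimately have "|seqs \<kappa> (Field \<kappa>)| \<le>o |Pow (Field \<kappa> \<times> Field \<kappa>)|"
    using card_of_ordLeq by blast
  moreover have "|Pow (Field \<kappa> \<times> Field \<kappa>)| =o ctwo ^c |Field \<kappa> \<times> Field \<kappa>|" by (rule card_of_Pow_ctwo)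
  moreover have "ctwo ^c |Field \<kappa> \<times> Field \<kappa>| =o ctwo ^c \<kappa>"
  proof (rule cexp_cong2)
    show "|Field \<kappa> \<times> Field \<kappa>| =o \<kappa>"
      using card_of_Times_same_infinite[OF infinite_Field] card_of_Field_ordIso[OF Card_order]
      by (rule ordIso_transitive)
  qed (simp_all add: Card_order Card_order_ctwo card_of_Card_order)
  ultimately show ?thesis by (metis ordLeq_ordIso_trans)
qed

lemma infinite_seqs_bool: "infinite (seqs \<kappa> (UNIV :: bool set))"
  using Field_ordLeq_seqs infinite_Field card_of_ordLeq_infinite by blast

text \<open>A nonempty set of size at most 2^{<\<kappa>} is the image of
  \<open>seqs \<kappa> UNIV\<close> under a function, so there are at most
  (2^\<kappa>)^(2^{<\<kappa>}) = 2^(2^{<\<kappa>}) = 2^\<kappa> such sets of nodes.\<close>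

lemma card_small_sets:
  assumes two: "ctwo ^c two_less \<kappa> =o ctwo ^c \<kappa>"
  shows "|{T. T \<noteq> {} \<and> T \<subseteq> seqs \<kappa> (Field \<kappa>) \<and> |T| \<le>o |seqs \<kappa> (UNIV :: bool set)| }| \<le>o ctwo ^c \<kappa>"
    (is "|?X| \<le>o _")
proof -
  let ?B = "seqs \<kappa> (UNIV :: bool set)" and ?K = "seqs \<kappa> (Field \<kappa>)"
  have B: "Cinfinite |?B|" "Cnotzero |?B|"
  proof -
    show "Cinfinite |?B|"
      using infinite_seqs_bool card_of_card_order_on by (simp add: cinfinite_def Field_card_of)
    then show "Cnotzero |?B|" by (rule Cinfinite_Cnotzero)
  qed
  have "?X \<subseteq> (\<lambda>g. g ` ?B) ` Func ?B ?K"
  proof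
    fix T assume T: "T \<in> ?X"
    then obtain g where g: "g ` ?B = T" using card_of_ordLeq2[of T ?B] by blast
    let ?g = "\<lambda>x. if x \<in> ?B then g x else undefined"
    have "?g ` ?B = T" using g by auto
    moreover have "?g \<in> Func ?B ?K" using T g by (auto simp: Func_def)
    ultimately show "T \<in> (\<lambda>g. g ` ?B) ` Func ?B ?K" by blast
  qed
  then have "|?X| \<le>o |Func ?B ?K|" by (rule ordLeq_transitive[OF card_of_mono1 card_of_image])
  then have 1: "|?X| \<le>o |?K| ^c |?B|" by (simp add: cexp_def Field_card_of)
  have "ctwo ^c \<kappa> =o ctwo ^c |?B|" using two ordIso_symmetric unfolding two_less_def by blast
  then have "|?K| \<le>o ctwo ^c |?B|" by (rule ordLeq_ordIso_trans[OF card_seqs_Field])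
  then have "|?K| ^c |?B| \<le>o (ctwo ^c |?B| ) ^c |?B|"
    by (rule cexp_mono1) (rule card_of_Card_order)
  then have 2: "|?X| \<le>o (ctwo ^c |?B| ) ^c |?B|" by (rule ordLeq_transitive[OF 1])
  have "(ctwo ^c |?B| ) ^c |?B| =o ctwo ^c |?B|"
    by (rule cexp_cprod_ordLeq) (simp_all add: B Card_order_ctwo ordLeq_refl)
  then have "|?X| \<le>o ctwo ^c |?B|" by (rule ordLeq_ordIso_trans[OF 2])
  then show ?thesis using two unfolding two_less_def by (rule ordLeq_ordIso_trans)
qed

end

section \<open>Adding a Cohen real\<close>

text \<open>Dense sets are subsets of a set of size 2^{<\<kappa>}, so there are at most
  2^(2^{<\<kappa>}) = 2^\<kappa> of them as well.\<close>

lemma (in infinite_cardinal) card_tree_dense_pairs: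
  assumes two: "ctwo ^c two_less \<kappa> =o ctwo ^c \<kappa>"
  shows "|{T. T \<noteq> {} \<and> T \<subseteq> seqs \<kappa> (Field \<kappa>) \<and> |T| \<le>o |seqs \<kappa> (UNIV :: bool set)| } \<times>
      {D. dense (cohen \<kappa>) D}| \<le>o ctwo ^c \<kappa>"
proof (rule card_of_Times_ordLeq_infinite_Field[OF _ card_small_sets[OF two] _ Card_order_cexp])
  show "infinite (Field (ctwo ^c \<kappa>))"
    using Cinfinite_cexp[OF ordLeq_refl[OF Card_order_ctwo] Cinfinite] by (simp add: cinfinite_def)
  have "{D. dense (cohen \<kappa>) D} \<subseteq> Pow (seqs \<kappa> UNIV)"
    by (auto simp: dense_def cohen_def)
  then have "|{D. dense (cohen \<kappa>) D}| \<le>o |Pow (seqs \<kappa> (UNIV :: bool set))|" by (rule card_of_mono1)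
  then have "|{D. dense (cohen \<kappa>) D}| \<le>o ctwo ^c two_less \<kappa>"
    unfolding two_less_def by (rule ordLeq_ordIso_trans[OF _ card_of_Pow_ctwo])
  then show "|{D. dense (cohen \<kappa>) D}| \<le>o ctwo ^c \<kappa>" by (rule ordLeq_ordIso_trans[OF _ two])
qed

theorem lemma4p1:
  fixes \<kappa> :: "'k rel"
  assumes "Card_order \<kappa>" and "natLeq <o \<kappa>"
    and "collapses (Q1 \<kappa>) (ctwo ^c \<kappa>) natLeq"
    and "natLeq <o cofinality \<kappa>"
    and "ctwo ^c two_less \<kappa> =o ctwo ^c \<kappa>"
  shows "adds_cohen_real (Q2 \<kappa>) \<kappa>"
proof -
  have "Cinfinite \<kappa>"
    using assms(1) cinfinite_mono[OF ordLess_imp_ordLeq[OF assms(2)] natLeq_cinfinite] by simp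
  then interpret infinite_cardinal \<kappa> by unfold_locales
  let ?C = "seqs \<kappa> (UNIV :: bool set)"
  \<comment> \<open>Indexing by pairs attaches each dense set to every small tree, and the small
    trees are dense by \<open>small_subtree\<close>.\<close>
  define I where "I = {T. miller_tree \<kappa> T \<and> |T| \<le>o |?C| } \<times> {D. dense (cohen \<kappa>) D}"
  have "I \<subseteq> {T. T \<noteq> {} \<and> T \<subseteq> seqs \<kappa> (Field \<kappa>) \<and> |T| \<le>o |?C| } \<times> {D. dense (cohen \<kappa>) D}"
    using millerD(1,2) unfolding I_def by blast
  then have card_I: "|I| \<le>o ctwo ^c \<kappa>"
    by (rule ordLeq_transitive[OF card_of_mono1 card_tree_dense_pairs[OF assms(5)]])
  \<comment> \<open>The default \<open>Field \<kappa>\<close> where the tree does not split makes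
    \<open>a t i\<close> a condition for all \<open>i\<close>, so the family can be thinned over the
    same index set at each node \<open>t\<close>.\<close>
  define a where "a t i = (if splitting \<kappa> (fst i) t then succs (fst i) t else Field \<kappa>)"
    for t and i :: "('k \<rightharpoonup> 'k) set \<times> ('k \<rightharpoonup> bool) set"
  have "a t i \<in> conds (Q1 \<kappa>)" for t i
    unfolding a_def Q1_conds by (auto simp: splitting_def card_of_Field_ordIso[OF Card_order])
  then have "\<exists>b. \<forall>i\<in>I. b i \<in> conds (Q1 \<kappa>) \<and> b i \<subseteq> a t i \<and>
      finite {j \<in> earlier I i. |b j \<inter> b i| =o \<kappa>}" for t
    by (intro thin_family[OF Cinfinite assms(3) card_I])
  then have "\<forall>t. \<exists>b. \<forall>i\<in>I. b i \<in> conds (Q1 \<kappa>) \<and> b i \<subseteq> a t i \<and>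
      finite {j \<in> earlier I i. |b j \<inter> b i| =o \<kappa>}" by (rule allI)
  from choice[OF this] obtain b where
    b: "\<And>t i. i \<in> I \<Longrightarrow> b t i \<in> conds (Q1 \<kappa>)" "\<And>t i. i \<in> I \<Longrightarrow> b t i \<subseteq> a t i"
    "\<And>t i. i \<in> I \<Longrightarrow> finite {j \<in> earlier I i. |b t j \<inter> b t i| =o \<kappa>}"
    by blast
  have "\<exists>S. miller_tree \<kappa> S \<and> S \<subseteq> fst i \<and> (\<forall>t. splitting \<kappa> S t \<longrightarrow> succs S t = b t i)" if i: "i \<in> I" for i
  proof -
    have T: "miller_tree \<kappa> (fst i)" using i unfolding I_def by auto
    show ?thesis
    proof (rule thin_tree[OF T, of "\<lambda>t. b t i"])
      show "b t i \<subseteq> succs (fst i) t" if "splitting \<kappa> (fst i) t" for t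
        using b(2)[OF i, of t] that by (simp add: a_def)
      show "|b t i| =o \<kappa>" for t using b(1)[OF i, of t] by (simp add: Q1_conds)
    qed blast
  qed
  then have "\<forall>i\<in>I. \<exists>S. miller_tree \<kappa> S \<and> S \<subseteq> fst i \<and> (\<forall>t. splitting \<kappa> S t \<longrightarrow> succs S t = b t i)"
    by (rule ballI)
  from bchoice[OF this] obtain S0 where S0: "\<And>i. i \<in> I \<Longrightarrow> miller_tree \<kappa> (S0 i)" "\<And>i. i \<in> I \<Longrightarrow> S0 i \<subseteq> fst i"
    "\<And>i t. i \<in> I \<Longrightarrow> splitting \<kappa> (S0 i) t \<Longrightarrow> succs (S0 i) t = b t i" by blast
  \<comment> \<open>At a common splitting node the successor sets are \<open>b t j\<close> and
    \<open>b t i\<close>, so the finiteness of the thinned family applies.\<close>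
  have fin: "finite {j \<in> earlier I i. splitting \<kappa> (S0 j) t \<and> |succs (S0 j) t \<inter> succs (S0 i) t| =o \<kappa>}"
    if "i \<in> I" "splitting \<kappa> (S0 i) t" for i t
  proof (rule finite_subset[OF _ b(3)[OF that(1), of t]])
    show "{j \<in> earlier I i. splitting \<kappa> (S0 j) t \<and> |succs (S0 j) t \<inter> succs (S0 i) t| =o \<kappa>}
        \<subseteq> {j \<in> earlier I i. |b t j \<inter> b t i| =o \<kappa>}"
    proof (intro subsetI CollectI, elim CollectE conjE, intro conjI)
      fix j assume j: "j \<in> earlier I i" "splitting \<kappa> (S0 j) t" "|succs (S0 j) t \<inter> succs (S0 i) t| =o \<kappa>"
      then show "|b t j \<inter> b t i| =o \<kappa>" using S0(3)[OF underS_card_of[OF j(1)] j(2)] S0(3)[OF that] by simp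
    qed
  qed
  obtain S n where S: "\<And>i. i \<in> I \<Longrightarrow> miller_tree \<kappa> (S i)" "\<And>i. i \<in> I \<Longrightarrow> S i \<subseteq> S0 i"
    and antichain: "\<And>i j R. i \<in> I \<Longrightarrow> j \<in> I \<Longrightarrow> n i = (n j :: nat) \<Longrightarrow> miller_tree \<kappa> R \<Longrightarrow> R \<subseteq> S i \<Longrightarrow> R \<subseteq> S j \<Longrightarrow> i = j"
  proof (rule antichain_refinement[OF assms(4) S0(1) fin])
    fix S n
    assume "\<And>i. i \<in> I \<Longrightarrow> miller_tree \<kappa> (S i)" "\<And>i. i \<in> I \<Longrightarrow> S i \<subseteq> S0 i"
      "\<And>i j R. i \<in> I \<Longrightarrow> j \<in> I \<Longrightarrow> n i = (n j :: nat) \<Longrightarrow> miller_tree \<kappa> R \<Longrightarrow> R \<subseteq> S i \<Longrightarrow> R \<subseteq> S j \<Longrightarrow> i = j"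
    then show thesis by (rule that)
  qed
  show ?thesis
    unfolding adds_cohen_real_def
  proof (rule adds_generic_if_antichains[where I = I and S = S and n = n and D = snd])
    show "Map.empty \<in> conds (cohen \<kappa>)" by (simp add: cohen_def empty_in_seqs)
    show "le (cohen \<kappa>) c e" if "le (cohen \<kappa>) c d" "le (cohen \<kappa>) d e" for c d e
      using that map_le_trans by (auto simp: cohen_def)
    show "dense (cohen \<kappa>) (snd i)" if "i \<in> I" for i using that unfolding I_def by auto
    show "snd i = snd j" if "i \<in> I" "j \<in> I" "n i = n j" "r \<in> conds (Q2 \<kappa>)" "le (Q2 \<kappa>) (S i) r" "le (Q2 \<kappa>) (S j) r"
      for i j r
      using antichain[OF that(1-3), of r] that(4-) by (simp add: Q2_def)
    \<comment> \<open>A small subtree \<open>T\<close> of \<open>p\<close> gives the index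
      \<open>(T, E)\<close>, and \<open>S (T, E)\<close> is contained in \<open>T\<close>.\<close>
    show "\<exists>i\<in>I. snd i = E \<and> le (Q2 \<kappa>) p (S i)" if p: "p \<in> conds (Q2 \<kappa>)" and E: "dense (cohen \<kappa>) E" for p E
    proof -
      obtain T where T: "miller_tree \<kappa> T" "T \<subseteq> p" "|T| \<le>o |?C|"
        using p small_subtree[of p] by (auto simp: Q2_def)
      then have "(T, E) \<in> I" using E unfolding I_def by blast
      moreover from this have "S (T, E) \<subseteq> p" using S(2) S0(2) T(2) by fastforce
      ultimately show ?thesis by (force simp: Q2_def)
    qed
  qed (use S(1) in \<open>auto simp: Q2_def cohen_def\<close>)
qed

end
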